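(* Let $(\mathcal{G},\mathbf{p}^* )$ be the target formation with $l$ stationary leaders ($2\le l<n$) and let the followers $i=l+1,\dots,n$ obey $\dot{\mathbf p}_i=\mathbf u_i+\mathbf d_i$ under the displacement-based adaptive control law $$\mathbf u_i=-\sum_{j\in\mathcal N_i}\gamma_{ij}\mathbf P_{\mathbf g_{ij}^*}\,\mathrm{sgn}(\mathbf q_{ij}),\qquad \mathbf q_{ij}=\mathbf P_{\mathbf g_{ij}^*}(\mathbf p_i-\mathbf p_j),\qquad \dot\gamma_{ij}=\kappa\|\mathbf q_{ij}\|_1\quad ((i,j)\in\mathcal E),$$ with $\gamma_{ij}(0)>0$ and $\kappa>0$, under the standing assumptions listed in the context. Then for every Filippov solution on $[0,\infty)$: (i) $\mathbf p(t)\to\mathbf p^*$ as $t\to+\infty$. (ii) There exists a constant vector $\boldsymbol\gamma^*=[\gamma_1^*,\dots,\gamma_m^*]^\top$ such that $\boldsymbol\gamma(t)=[\gamma_1(t),\dots,\gamma_m(t)]^\top\to\boldsymbol\gamma^*$ as $t\to+\infty$. (iii) If, additionally, $\gamma_k^*>\gamma_0:=\beta\sqrt{\dfrac{dn}{\lambda_{\min}(\mathbf L_{ff}^* )}}$ for all $k=1,\dots,m$, and there exists a finite time $T$ such that $|\gamma_k(T)-\gamma_k^*|<\min_{k'}|\gamma_{k'}(T)-\gamma_0|$ for all $k=1,\dots,m$, then $\mathbf p(t)\to\mathbf p^*$ in finite time, i.e. there is $T'<\infty$ with $\mathbf p(t)=\mathbf p^*$ for all $t\ge T'$.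
   Context: Setting. $d\ge 2$; $\mathcal G=(\mathcal V,\mathcal E)$ is an undirected graph without self-loops, $|\mathcal V|=n$, $|\mathcal E|=m$, edges indexed $e_1,\dots,e_m$ and arbitrarily oriented; $\mathcal N_i$ is the neighbor set of $i$. Agent $i$ has position $\mathbf p_i(t)\in\mathbb R^d$ (all in a common orientation), $\mathbf p=[\mathbf p_1^\top,\dots,\mathbf p_n^\top]^\top$. Agents $1,\dots,l$ are leaders, $l+1,\dots,n$ followers, $f=n-l$. Bearing rigidity. For a configuration $\mathbf p$ with distinct points, $\mathbf z_{ij}=\mathbf p_j-\mathbf p_i$, $\mathbf g_{ij}=\mathbf z_{ij}/\|\mathbf z_{ij}\|$, and $\mathbf P_{\mathbf g}=\mathbf I_d-\mathbf g\mathbf g^\top$ for a unit vector $\mathbf g$; for an edge $e_k=(i,j)$ write $\mathbf g_k=\mathbf g_{ij}$. $\mathbf H=[h_{ki}]\in\mathbb R^{m\times n}$ is the incidence matrix ($h_{ki}=-1$ if $i$ is the start vertex of $e_k$, $+1$ if the end vertex, $0$ otherwise), $\bar{\mathbf H}=\mathbf H\otimes\mathbf I_d$. $\tilde{\mathbf R}_b=\mathrm{blkdiag}(\mathbf P_{\mathbf g_k})\bar{\mathbf H}$ and the bearing Laplacian is $\mathbf L_b=\tilde{\mathbf R}_b^\top\tilde{\mathbf R}_b$. The formation is infinitesimally bearing rigid in $\mathbb R^d$ if $\mathrm{rank}(\tilde{\mathbf R}_b)=dn-d-1$. Target formation. $\mathbf p^*=[\mathbf p_1^{*\top},\dots,\mathbf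 p_n^{*\top}]^\top$ has distinct points, $(\mathcal G,\mathbf p^* )$ is infinitesimally bearing rigid in $\mathbb R^d$, and $\mathbf g_{ij}^*$ denote its bearing vectors. $\mathbf L_{ff}^*$ is the lower-right $df\times df$ (follower-follower) block of $\mathbf L_b$ evaluated at $\mathbf p^*$; it is known to be symmetric positive definite, with smallest eigenvalue $\lambda_{\min}(\mathbf L_{ff}^* )$. Leaders are stationary at their target positions: $\mathbf p_i(t)=\mathbf p_i^*$ for $i\le l$, $t\ge 0$. Disturbance. $\mathbf d(t)=[\mathbf d_1(t)^\top,\dots,\mathbf d_n(t)^\top]^\top$ is bounded and uniformly continuous on $[0,\infty)$, and $\beta=\sup_{t\ge0}\|\mathbf d(t)\|_\infty>0$. It is assumed that there is no collision between agents ($\mathbf p_i(t)\ne\mathbf p_j(t)$ for $i\neq j$). Conventions. $\mathrm{sgn}$ acts componentwise, with $\mathrm{sgn}(0)=0$; there is one gain per undirected edge, $\gamma_{ij}=\gamma_{ji}=\gamma_k$ for $e_k=(i,j)$. Solutions are in the Filippov sense: for the state $\mathbf x=(\mathbf p_{l+1},\dots,\mathbf p_n,\boldsymbol\gamma)$ with closed-loop right-hand side $F(t,\mathbf x)$, a solution is a locally absolutely continuous function with $\dot{\mathbf x}\in K[F](t,\mathbf x)$ for almost every $t$, where $K[F](t,\mathbf x)=\bigcap_{\epsilon>0}\bigcap_{\mu(S)=0}\overline{\mathrm{co}}\,F(t,B(\mathbf x,\epsilon)\setminus S)$ and $\mu$ is Lebesgue measure. *)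

theory Defs
  imports "HOL-Analysis.Analysis"
begin

text \<open>
  A configuration of agents indexed by \<open>'v\<close> in dimension \<open>CARD('d)\<close> has type \<open>real^'d^'v\<close>.
  In the leader-follower setting the index type is \<open>'l + 'f\<close>, with leaders \<open>Inl i\<close> and
  followers \<open>Inr i\<close>. Edges are indexed by a finite type \<open>'e\<close>, and edge \<open>k\<close> is oriented from
  \<open>src k\<close> to \<open>tgt k\<close>. Stacked vectors and block matrices are indexed by pairs
  (block, coordinate).
\<close>

definition oriented_graph :: "'v set set \<Rightarrow> ('e \<Rightarrow> 'v) \<Rightarrow> ('e \<Rightarrow> 'v) \<Rightarrow> bool" where
  "oriented_graph E src tgt \<longleftrightarrow>
     (\<forall>e\<in>E. card e = 2) \<and> bij_betw (\<lambda>k. {src k, tgt k}) UNIV E"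

definition neighbors :: "'v set set \<Rightarrow> 'v \<Rightarrow> 'v set" where
  "neighbors E i = {j. {i, j} \<in> E}"

definition edge_index :: "('e \<Rightarrow> 'v) \<Rightarrow> ('e \<Rightarrow> 'v) \<Rightarrow> 'v \<Rightarrow> 'v \<Rightarrow> 'e" where
  "edge_index src tgt i j = (THE k. {src k, tgt k} = {i, j})"

definition incidence_matrix :: "('e \<Rightarrow> 'v) \<Rightarrow> ('e \<Rightarrow> 'v) \<Rightarrow> real^'v^'e" where
  "incidence_matrix src tgt =
     (\<chi> k i. if i = src k then - 1 else if i = tgt k then 1 else 0)"

definition bearing :: "real^'d^'v \<Rightarrow> 'v \<Rightarrow> 'v \<Rightarrow> real^'d" where
  "bearing p i j = (p $ j - p $ i) /\<^sub>R norm (p $ j - p $ i)"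

definition proj_matrix :: "real^'d \<Rightarrow> real^'d^'d" where
  "proj_matrix g = mat 1 - (\<chi> a b. g $ a * g $ b)"

definition kronecker :: "real^'b^'a \<Rightarrow> real^'d^'c \<Rightarrow> real^('b::finite \<times> 'd::finite)^('a::finite \<times> 'c::finite)" where
  "kronecker A B = (\<chi> r c. A $ fst r $ fst c * B $ snd r $ snd c)"

definition blkdiag :: "('e::finite \<Rightarrow> real^'d^'d) \<Rightarrow> real^('e \<times> 'd::finite)^('e \<times> 'd)" where
  "blkdiag B = (\<chi> r c. if fst r = fst c then B (fst r) $ snd r $ snd c else 0)"

definition bearing_rigidity_matrix ::
  "('e::finite \<Rightarrow> 'v::finite) \<Rightarrow> ('e \<Rightarrow> 'v) \<Rightarrow> real^'d::finite^'v \<Rightarrow> real^('v \<times> 'd)^('e \<times> 'd)" where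
  "bearing_rigidity_matrix src tgt p =
     blkdiag (\<lambda>k. proj_matrix (bearing p (src k) (tgt k)))
       ** kronecker (incidence_matrix src tgt) (mat 1 :: real^'d^'d)"

definition bearing_laplacian ::
  "('e::finite \<Rightarrow> 'v::finite) \<Rightarrow> ('e \<Rightarrow> 'v) \<Rightarrow> real^'d::finite^'v \<Rightarrow> real^('v \<times> 'd)^('v \<times> 'd)" where
  "bearing_laplacian src tgt p =
     transpose (bearing_rigidity_matrix src tgt p) ** bearing_rigidity_matrix src tgt p"

definition infinitesimally_bearing_rigid ::
  "('e::finite \<Rightarrow> 'v::finite) \<Rightarrow> ('e \<Rightarrow> 'v) \<Rightarrow> real^'d^'v \<Rightarrow> bool" where
  "infinitesimally_bearing_rigid src tgt p \<longleftrightarrow>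
     int (rank (bearing_rigidity_matrix src tgt p)) =
       int (CARD('d) * CARD('v)) - int CARD('d) - 1"

definition follower_block ::
  "real^(('l::finite + 'f::finite) \<times> 'd::finite)^(('l + 'f) \<times> 'd) \<Rightarrow> real^('f \<times> 'd)^('f \<times> 'd)" where
  "follower_block L = (\<chi> r c. L $ (Inr (fst r), snd r) $ (Inr (fst c), snd c))"

text \<open>Meaningful for matrices whose eigenvalues are all real, such as symmetric ones.\<close>

definition min_eigenvalue :: "real^'n^'n \<Rightarrow> real" where
  "min_eigenvalue A = Min {c. \<exists>v. v \<noteq> 0 \<and> A *v v = c *\<^sub>R v}"

definition filippov_map ::
  "(real \<Rightarrow> 'a::euclidean_space \<Rightarrow> 'a) \<Rightarrow> real \<Rightarrow> 'a \<Rightarrow> 'a set" where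
  "filippov_map F t x =
     (\<Inter>\<epsilon>\<in>{0<..}. \<Inter>S\<in>null_sets lebesgue. closure (convex hull (F t ` (ball x \<epsilon> - S))))"

text \<open>The finite set \<open>D\<close> represents a family of non-overlapping intervals by their end points.\<close>

definition absolutely_continuous_on_interval ::
  "real \<Rightarrow> real \<Rightarrow> (real \<Rightarrow> 'a::real_normed_vector) \<Rightarrow> bool" where
  "absolutely_continuous_on_interval a b f \<longleftrightarrow>
     (\<forall>\<epsilon>>0. \<exists>\<delta>>0. \<forall>D. finite D \<and>
        (\<forall>(s, t)\<in>D. a \<le> s \<and> s \<le> t \<and> t \<le> b) \<and>
        pairwise (\<lambda>(s, t) (s', t'). {s<..<t} \<inter> {s'<..<t'} = {}) D \<and>
        (\<Sum>(s, t)\<in>D. t - s) < \<delta>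
        \<longrightarrow> (\<Sum>(s, t)\<in>D. norm (f t - f s)) < \<epsilon>)"

definition filippov_solution ::
  "(real \<Rightarrow> 'a::euclidean_space \<Rightarrow> 'a) \<Rightarrow> (real \<Rightarrow> 'a) \<Rightarrow> bool" where
  "filippov_solution F x \<longleftrightarrow>
     (\<forall>a b. 0 \<le> a \<and> a \<le> b \<longrightarrow> absolutely_continuous_on_interval a b x) \<and>
     (AE t in lebesgue. 0 \<le> t \<longrightarrow>
        (\<exists>v \<in> filippov_map F t (x t). (x has_vector_derivative v) (at t within {0..})))"

text \<open>The library's \<open>sgn\<close> on vectors normalizes; this is the componentwise sign.\<close>

definition sgn_vec :: "real^'d \<Rightarrow> real^'d" where
  "sgn_vec x = (\<chi> c. sgn (x $ c))"

definition norm1 :: "real^'d \<Rightarrow> real" where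
  "norm1 x = (\<Sum>c\<in>UNIV. \<bar>x $ c\<bar>)"

definition displacement :: "real^'d^'v \<Rightarrow> real^'d^'v \<Rightarrow> 'v \<Rightarrow> 'v \<Rightarrow> real^'d" where
  "displacement pstar p i j = proj_matrix (bearing pstar i j) *v (p $ i - p $ j)"

definition control ::
  "real^'d^'v \<Rightarrow> 'v set set \<Rightarrow> ('e \<Rightarrow> 'v) \<Rightarrow> ('e \<Rightarrow> 'v) \<Rightarrow>
   real^'d^'v \<Rightarrow> real^'e \<Rightarrow> 'v \<Rightarrow> real^'d" where
  "control pstar E src tgt p \<gamma> i =
     - (\<Sum>j\<in>neighbors E i. (\<gamma> $ edge_index src tgt i j) *\<^sub>R
          (proj_matrix (bearing pstar i j) *v sgn_vec (displacement pstar p i j)))"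

definition with_leaders :: "real^'d^('l::finite + 'f::finite) \<Rightarrow> real^'d^'f \<Rightarrow> real^'d^('l + 'f)" where
  "with_leaders pstar y = (\<chi> i. case i of Inl a \<Rightarrow> pstar $ Inl a | Inr b \<Rightarrow> y $ b)"

text \<open>
  Right-hand side of the closed loop for the state (follower positions, gains); the leaders
  stay at their target positions and \<open>w\<close> is the disturbance.
\<close>

definition closed_loop ::
  "real^'d^('l::finite + 'f::finite) \<Rightarrow> ('l + 'f) set set \<Rightarrow>
   ('e::finite \<Rightarrow> 'l + 'f) \<Rightarrow> ('e \<Rightarrow> 'l + 'f) \<Rightarrow> real \<Rightarrow>
   (real \<Rightarrow> real^'d^('l + 'f)) \<Rightarrow> real \<Rightarrow>
   (real^'d^'f) \<times> (real^'e) \<Rightarrow> (real^'d^'f) \<times> (real^'e)" where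
  "closed_loop pstar E src tgt \<kappa> w t x =
     (let p = with_leaders pstar (fst x); \<gamma> = snd x in
       (\<chi> i. control pstar E src tgt p \<gamma> (Inr i) + w t $ Inr i,
        \<chi> k. \<kappa> * norm1 (displacement pstar p (src k) (tgt k))))"

end

theory Submission
  imports Defs
begin

text \<open>
  Let \<open>z = p - p*\<close>, let \<open>q\<^sub>k\<close> be the displacement along edge \<open>k\<close>, and let \<open>S = \<Sum>k. \<parallel>q\<^sub>k\<parallel>\<^sub>1\<close>. Every
  Filippov velocity satisfies \<open>z \<bullet> z' = z \<bullet> w - \<Sum>k. \<gamma>\<^sub>k \<parallel>q\<^sub>k\<parallel>\<^sub>1\<close>, because the discontinuity of the
  sign in a coordinate is multiplied by that same coordinate of \<open>q\<^sub>k\<close>. Rigidity and two fixed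
  leaders give \<open>\<lambda> \<parallel>z\<parallel>\<^sup>2 \<le> \<Sum>k. \<parallel>q\<^sub>k\<parallel>\<^sup>2 \<le> S\<^sup>2\<close> with \<open>\<lambda> > 0\<close>, the least eigenvalue of the
  follower block, so that \<open>z \<bullet> w \<le> \<gamma>\<^sub>0 S\<close>. Hence
  \<open>\<parallel>z\<parallel>\<^sup>2 / 2 + (\<Sum>k. (\<gamma>\<^sub>k - \<gamma>\<^sub>0)\<^sup>2) / (2\<kappa>)\<close> is nonincreasing. The gains are therefore bounded, and
  since they are nondecreasing they converge. For \<open>C\<close> bounding all \<open>|\<gamma>\<^sub>k - \<gamma>\<^sub>0|\<close>, the function
  \<open>\<parallel>z\<parallel>\<^sup>2 / 2 - (C / \<kappa>) \<Sum>k. \<gamma>\<^sub>k\<close> is also nonincreasing and bounded below, so \<open>\<parallel>z\<parallel>\<close> converges; a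
  nonzero limit would make \<open>\<Sum>k. \<gamma>\<^sub>k\<close> grow without bound. Once all gains exceed \<open>\<gamma>\<^sub>0 + m\<close> with
  \<open>m > 0\<close>, the distance \<open>\<parallel>z\<parallel>\<close> decreases at least at the rate \<open>m \<surd>\<lambda>\<close> until it vanishes.
\<close>

section \<open>Absolutely continuous functions\<close>

lemma absolutely_continuous_on_intervalE:
  assumes "absolutely_continuous_on_interval a b f" "\<epsilon> > 0"
  obtains \<delta> where "\<delta> > 0" "\<And>D. \<lbrakk>finite D; \<And>s t. (s, t) \<in> D \<Longrightarrow> a \<le> s \<and> s \<le> t \<and> t \<le> b;
      pairwise (\<lambda>(s, t) (s', t'). {s<..<t} \<inter> {s'<..<t'} = {}) D; (\<Sum>(s, t)\<in>D. t - s) < \<delta>\<rbrakk>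
    \<Longrightarrow> (\<Sum>(s, t)\<in>D. norm (f t - f s)) < \<epsilon>"
proof -
  from assms obtain \<delta> where "\<delta> > 0" and \<delta>: "\<forall>D. finite D \<and>
        (\<forall>(s, t)\<in>D. a \<le> s \<and> s \<le> t \<and> t \<le> b) \<and>
        pairwise (\<lambda>(s, t) (s', t'). {s<..<t} \<inter> {s'<..<t'} = {}) D \<and>
        (\<Sum>(s, t)\<in>D. t - s) < \<delta> \<longrightarrow> (\<Sum>(s, t)\<in>D. norm (f t - f s)) < \<epsilon>"
    unfolding absolutely_continuous_on_interval_def by blast
  show thesis
    by (rule that[OF \<open>\<delta> > 0\<close>], rule \<delta>[rule_format]) auto
qed

text \<open>The budget \<open>\<epsilon>\<close> is split between the increments of \<open>f\<close>
  and the total length of the intervals. The length term admits functions with a linear drift in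
  time, as in the Lyapunov functions below.\<close>

lemma absolutely_continuous_on_interval_dominated:
  assumes f: "absolutely_continuous_on_interval a b f"
    and le: "\<And>s t. s \<in> {a..b} \<Longrightarrow> t \<in> {a..b} \<Longrightarrow> s \<le> t \<Longrightarrow>
      norm (g t - g s) \<le> C * norm (f t - f s) + C' * (t - s)"
  shows "absolutely_continuous_on_interval a b g"
  unfolding absolutely_continuous_on_interval_def
proof (intro allI impI)
  fix \<epsilon> :: real assume "\<epsilon> > 0"
  define B where "B = \<bar>C\<bar> + \<bar>C'\<bar> + 1"
  have B: "B > 0" "C \<le> B" "C' \<le> B" by (auto simp: B_def)
  then have "\<epsilon> / (2 * B) > 0" using \<open>\<epsilon> > 0\<close> by simp
  then obtain \<delta> where "\<delta> > 0" and \<delta>: "\<And>D. finite D \<Longrightarrow> (\<And>s t. (s, t) \<in> D \<Longrightarrow> a \<le> s \<and> s \<le> t \<and> t \<le> b) \<Longrightarrow>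
        pairwise (\<lambda>(s, t) (s', t'). {s<..<t} \<inter> {s'<..<t'} = {}) D \<Longrightarrow>
        (\<Sum>(s, t)\<in>D. t - s) < \<delta> \<Longrightarrow> (\<Sum>(s, t)\<in>D. norm (f t - f s)) < \<epsilon> / (2 * B)"
    using absolutely_continuous_on_intervalE[OF f \<open>\<epsilon> / (2 * B) > 0\<close>] by blast
  show "\<exists>\<delta>>0. \<forall>D. finite D \<and> (\<forall>(s, t)\<in>D. a \<le> s \<and> s \<le> t \<and> t \<le> b) \<and>
        pairwise (\<lambda>(s, t) (s', t'). {s<..<t} \<inter> {s'<..<t'} = {}) D \<and>
        (\<Sum>(s, t)\<in>D. t - s) < \<delta> \<longrightarrow> (\<Sum>(s, t)\<in>D. norm (g t - g s)) < \<epsilon>"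
  proof (intro exI conjI allI impI; (elim conjE)?)
    show "min \<delta> (\<epsilon> / (2 * B)) > 0" using \<open>\<delta> > 0\<close> \<open>\<epsilon> / (2 * B) > 0\<close> by simp
  next
    fix D assume D: "finite D" "\<forall>(s, t)\<in>D. a \<le> s \<and> s \<le> t \<and> t \<le> b"
        "pairwise (\<lambda>(s, t) (s', t'). {s<..<t} \<inter> {s'<..<t'} = {}) D"
        "(\<Sum>(s, t)\<in>D. t - s) < min \<delta> (\<epsilon> / (2 * B))"
    have "(\<Sum>(s, t)\<in>D. norm (g t - g s)) \<le> (\<Sum>(s, t)\<in>D. B * norm (f t - f s) + B * (t - s))"
    proof (rule sum_mono, clarify)
      fix s t assume "(s, t) \<in> D"
      then have st: "a \<le> s" "s \<le> t" "t \<le> b" using D(2) by auto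
      then have "norm (g t - g s) \<le> C * norm (f t - f s) + C' * (t - s)" by (intro le) auto
      also have "\<dots> \<le> B * norm (f t - f s) + B * (t - s)"
        using B st by (intro add_mono mult_right_mono) auto
      finally show "norm (g t - g s) \<le> B * norm (f t - f s) + B * (t - s)" .
    qed
    also have "\<dots> = B * (\<Sum>(s, t)\<in>D. norm (f t - f s)) + B * (\<Sum>(s, t)\<in>D. t - s)"
      by (simp add: sum_distrib_left sum.distrib case_prod_unfold)
    also have "\<dots> < B * (\<epsilon> / (2 * B)) + B * (\<epsilon> / (2 * B))"
      using \<open>B > 0\<close> D by (intro add_strict_mono mult_strict_left_mono \<delta>) auto
    finally show "(\<Sum>(s, t)\<in>D. norm (g t - g s)) < \<epsilon>" using \<open>B > 0\<close> by simp
  qed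
qed

lemma absolutely_continuous_on_interval_imp_continuous_on:
  assumes f: "absolutely_continuous_on_interval a b f"
  shows "continuous_on {a..b} f"
  unfolding continuous_on_iff
proof (intro ballI allI impI)
  fix x \<epsilon> :: real assume x: "x \<in> {a..b}" and "\<epsilon> > 0"
  then obtain \<delta> where "\<delta> > 0" and \<delta>: "\<And>D. finite D \<Longrightarrow> (\<And>s t. (s, t) \<in> D \<Longrightarrow> a \<le> s \<and> s \<le> t \<and> t \<le> b) \<Longrightarrow>
        pairwise (\<lambda>(s, t) (s', t'). {s<..<t} \<inter> {s'<..<t'} = {}) D \<Longrightarrow>
        (\<Sum>(s, t)\<in>D. t - s) < \<delta> \<Longrightarrow> (\<Sum>(s, t)\<in>D. norm (f t - f s)) < \<epsilon>"
    using absolutely_continuous_on_intervalE[OF f \<open>\<epsilon> > 0\<close>] by blast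
  have "dist (f y) (f x) < \<epsilon>" if "y \<in> {a..b}" "dist y x < \<delta>" for y
    \<comment> \<open>A family consisting of one interval turns absolute continuity into ordinary
      continuity.\<close>
    using \<delta>[of "{(min x y, max x y)}"] x that
    by (cases "x \<le> y") (auto simp: dist_norm norm_minus_commute min_def max_def split: if_splits)
  then show "\<exists>d>0. \<forall>x'\<in>{a..b}. dist x' x < d \<longrightarrow> dist (f x') (f x) < \<epsilon>"
    using \<open>\<delta> > 0\<close> by blast
qed

text \<open>Both end points are compared with the tag \<open>x\<close> lying between them, so the
  two errors add up to at most \<open>e * (t - s)\<close>. Differentiability at the single point
  \<open>x\<close> suffices.\<close>

lemma straddle_upper_bound:
  fixes f :: "real \<Rightarrow> real"
  assumes "(f has_real_derivative v) (at x within S)" "v \<le> 0" "e > 0"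
  obtains d where "d > 0" "\<And>s t. \<lbrakk>s \<in> S; t \<in> S; s \<le> x; x \<le> t; x - s < d; t - x < d\<rbrakk>
      \<Longrightarrow> f t - f s \<le> e * (t - s)"
proof -
  from assms(1,3) obtain d where "d > 0"
    and d: "\<And>y. y \<in> S \<Longrightarrow> norm (y - x) < d \<Longrightarrow> norm (f y - f x - v * (y - x)) \<le> e * norm (y - x)"
    unfolding has_field_derivative_def has_derivative_within_alt by blast
  show ?thesis
  proof
    show "d > 0" by fact
    fix s t assume *: "s \<in> S" "t \<in> S" "s \<le> x" "x \<le> t" "x - s < d" "t - x < d"
    have "f t - f x - v * (t - x) \<le> e * (t - x)" using d[of t] * by (auto simp: abs_le_iff)
    moreover have "- (f s - f x - v * (s - x)) \<le> e * (x - s)" using d[of s] * by (auto simp: abs_le_iff)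
    moreover have "v * (t - s) \<le> 0" using * assms(2) by (intro mult_nonpos_nonneg) auto
    ultimately show "f t - f s \<le> e * (t - s)" by (simp add: algebra_simps)
  qed
qed

text \<open>
  Cousin's lemma is applied to a gauge that controls the increment by the derivative off the null
  set and keeps the intervals tagged in the null set inside a small open neighbourhood of it.
\<close>

lemma absolutely_continuous_nonincreasing:
  fixes f :: "real \<Rightarrow> real"
  assumes ab: "a \<le> b" and f: "absolutely_continuous_on_interval a b f" and N: "negligible N"
    and deriv: "\<And>t. t \<in> {a..b} - N \<Longrightarrow> \<exists>v\<le>0. (f has_real_derivative v) (at t within {a..b})"
  shows "f b \<le> f a"
proof -
  \<comment> \<open>The term \<open>e * (b - a)\<close> pays for intervals tagged where the
    derivative is controlled, the extra \<open>e\<close> for those tagged in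
    \<open>N\<close>.\<close>
  have *: "f b - f a \<le> e * (b - a) + e" if "e > 0" for e
  proof -
    obtain \<delta> where "\<delta> > 0" and \<delta>: "\<And>D. finite D \<Longrightarrow> (\<And>s t. (s, t) \<in> D \<Longrightarrow> a \<le> s \<and> s \<le> t \<and> t \<le> b) \<Longrightarrow>
        pairwise (\<lambda>(s, t) (s', t'). {s<..<t} \<inter> {s'<..<t'} = {}) D \<Longrightarrow>
        (\<Sum>(s, t)\<in>D. t - s) < \<delta> \<Longrightarrow> (\<Sum>(s, t)\<in>D. norm (f t - f s)) < e"
      using absolutely_continuous_on_intervalE[OF f \<open>e > 0\<close>] by blast
    have "N \<in> sets lebesgue" using N by (simp add: negligible_imp_sets)
    \<comment> \<open>Outer regularity bounds only \<open>U - N\<close>; since \<open>N\<close> is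
      negligible, the same bound passes to \<open>U\<close>.\<close>
    then obtain U where "open U" "N \<subseteq> U" and U: "U - N \<in> lmeasurable" "emeasure lebesgue (U - N) < ennreal \<delta>"
      using sets_lebesgue_outer_open \<open>\<delta> > 0\<close> by metis
    have Um: "U \<in> lmeasurable"
    proof -
      have "(U - N) \<union> N \<in> lmeasurable"
        using U(1) N by (intro fmeasurable.Un) (simp_all add: negligible_imp_measurable)
      moreover have "(U - N) \<union> N = U" using \<open>N \<subseteq> U\<close> by blast
      ultimately show ?thesis by simp
    qed
    have U\<delta>: "measure lebesgue U < \<delta>"
    proof -
      have "emeasure lebesgue U = emeasure lebesgue (U - N)"
        using N Um by (simp add: emeasure_Diff_null_set negligible_iff_null_sets fmeasurableD)
      then have "ennreal (measure lebesgue U) < ennreal \<delta>"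
        using U(2) by (simp add: emeasure_eq_measure2[OF Um])
      then show ?thesis by (simp add: ennreal_less_iff)
    qed
    have "\<exists>d>0. (x \<in> N \<longrightarrow> ball x d \<subseteq> U) \<and> (x \<in> {a..b} - N \<longrightarrow>
            (\<forall>s t. s \<in> {a..b} \<and> t \<in> {a..b} \<and> s \<le> x \<and> x \<le> t \<and> x - s < d \<and> t - x < d
               \<longrightarrow> f t - f s \<le> e * (t - s)))" for x
    proof (cases "x \<in> N")
      case True
      then show ?thesis using \<open>open U\<close> \<open>N \<subseteq> U\<close> open_contains_ball by blast
    next
      case False
      show ?thesis
      proof (cases "x \<in> {a..b}")
        case True
        then obtain v where "v \<le> 0" "(f has_real_derivative v) (at x within {a..b})"
          using deriv \<open>x \<notin> N\<close> by blast
        then obtain d where "d > 0" "\<And>s t. \<lbrakk>s \<in> {a..b}; t \<in> {a..b}; s \<le> x; x \<le> t; x - s < d; t - x < d\<rbrakk>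
            \<Longrightarrow> f t - f s \<le> e * (t - s)"
          using straddle_upper_bound[OF _ _ \<open>e > 0\<close>] by blast
        then show ?thesis using \<open>x \<notin> N\<close> by (intro exI[of _ d]) blast
      qed (use \<open>x \<notin> N\<close> zero_less_one in blast)
    qed
    then obtain d where d0: "\<And>x. d x > 0" and dN: "\<And>x. x \<in> N \<Longrightarrow> ball x (d x) \<subseteq> U"
      and dS: "\<And>x s t. \<lbrakk>x \<in> {a..b} - N; s \<in> {a..b}; t \<in> {a..b}; s \<le> x; x \<le> t; x - s < d x; t - x < d x\<rbrakk>
               \<Longrightarrow> f t - f s \<le> e * (t - s)"
      by metis
    have "gauge (\<lambda>x. ball x (d x))" using d0 by (simp add: gauge_ball_dependent)
    then obtain P where P: "P tagged_division_of cbox a b" and fine: "(\<lambda>x. ball x (d x)) fine P"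
      using fine_division_exists by blast
    note PD = tagged_division_ofD[OF P]
    have uv: "\<exists>u v. K = {u..v} \<and> Inf K = u \<and> Sup K = v \<and> a \<le> u \<and> u \<le> x \<and> x \<le> v \<and> v \<le> b
        \<and> K \<subseteq> ball x (d x)" if xK: "(x, K) \<in> P" for x K
    proof -
      obtain u v where 1: "K = {u..v}" using PD(4)[OF xK] by auto
      then have 2: "u \<le> x" "x \<le> v" using PD(2)[OF xK] by auto
      have "{u..v} \<subseteq> {a..b}" using PD(3)[OF xK] 1 by simp
      then have "a \<le> u" "v \<le> b" using 2 by auto
      moreover have "K \<subseteq> ball x (d x)" using fine xK by (auto simp: fine_def)
      ultimately show ?thesis using 1 2 by auto
    qed
    have K: "a \<le> Inf K" "Inf K \<le> x" "x \<le> Sup K" "Sup K \<le> b" "x - Inf K < d x" "Sup K - x < d x"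
        "interior K = {Inf K<..<Sup K}"
      if xK: "(x, K) \<in> P" for x K
    proof -
      from uv[OF xK] obtain u v where *: "K = {u..v}" "a \<le> u" "u \<le> x" "x \<le> v" "v \<le> b" "K \<subseteq> ball x (d x)"
        by blast
      then have "u \<in> {u..v}" "v \<in> {u..v}" by auto
      then have "dist x u < d x" "dist x v < d x" using * unfolding mem_ball[symmetric] by blast+
      with * show "a \<le> Inf K" "Inf K \<le> x" "x \<le> Sup K" "Sup K \<le> b" "x - Inf K < d x" "Sup K - x < d x"
        "interior K = {Inf K<..<Sup K}"
        by (simp_all add: dist_real_def)
    qed
    \<comment> \<open>Degenerate intervals contribute no increment. Without them, passing to end
      points is injective, because two elements with the same end points would have overlapping
      interiors.\<close>
    define B where "B = {(x, K) \<in> P. x \<in> N \<and> Inf K < Sup K}"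
    have "B \<subseteq> P" "finite B" using PD(1) by (auto simp: B_def intro: finite_subset)
    define \<phi> where "\<phi> = (\<lambda>(x :: real, K :: real set). (Inf K, Sup K))"
    have disj: "{Inf K<..<Sup K} \<inter> {Inf K'<..<Sup K'} = {}"
      if "(x, K) \<in> P" "(x', K') \<in> P" "(x, K) \<noteq> (x', K')" for x K x' K'
      using PD(5)[OF that] unfolding K(7)[OF that(1)] K(7)[OF that(2)] .
    have inj: "inj_on \<phi> B"
    proof (rule inj_onI, clarify)
      fix x K x' K' assume *: "(x, K) \<in> B" "(x', K') \<in> B" "\<phi> (x, K) = \<phi> (x', K')"
      show "x = x' \<and> K = K'"
      proof (rule ccontr)
        assume "\<not> (x = x' \<and> K = K')"
        then have "{Inf K<..<Sup K} \<inter> {Inf K'<..<Sup K'} = {}" using * by (intro disj) (auto simp: B_def)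
        then have "{Inf K<..<Sup K} = {}" using * by (auto simp: \<phi>_def)
        then show False using * by (auto simp: B_def)
      qed
    qed
    have D: "a \<le> s \<and> s \<le> t \<and> t \<le> b" if "(s, t) \<in> \<phi> ` B" for s t
    proof -
      from that obtain x K where "(x, K) \<in> P" "s = Inf K" "t = Sup K" by (auto simp: \<phi>_def B_def)
      then show "a \<le> s \<and> s \<le> t \<and> t \<le> b" using K(1-4)[of x K] by simp
    qed
    have pw: "pairwise (\<lambda>(s, t) (s', t'). {s<..<t} \<inter> {s'<..<t'} = {}) (\<phi> ` B)"
      unfolding pairwise_def
    proof (intro ballI impI)
      fix i j assume "i \<in> \<phi> ` B" "j \<in> \<phi> ` B" "i \<noteq> j"
      then obtain x K x' K' where "(x, K) \<in> B" "(x', K') \<in> B" "i = \<phi> (x, K)" "j = \<phi> (x', K')" "(x, K) \<noteq> (x', K')"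
        by (auto simp: image_iff)
      then show "(case i of (s, t) \<Rightarrow> \<lambda>(s', t'). {s<..<t} \<inter> {s'<..<t'} = {}) j"
        using disj[of x K x' K'] by (auto simp: \<phi>_def B_def)
    qed
    \<comment> \<open>The total length is the measure of a disjoint union contained in
      \<open>U\<close>, hence below \<open>\<delta>\<close>.\<close>
    have "(\<Sum>(s, t)\<in>\<phi> ` B. t - s) = (\<Sum>(x, K)\<in>B. Sup K - Inf K)"
      by (subst sum.reindex[OF inj]) (simp add: \<phi>_def case_prod_unfold)
    also have "\<dots> = (\<Sum>b\<in>B. measure lebesgue {Inf (snd b)<..<Sup (snd b)})"
      by (rule sum.cong) (auto simp: B_def)
    also have "\<dots> = measure lebesgue (\<Union>b\<in>B. {Inf (snd b)<..<Sup (snd b)})"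
    proof (rule measure_UNION'[symmetric, OF \<open>finite B\<close>])
      show "pairwise (\<lambda>i j. disjnt {Inf (snd i)<..<Sup (snd i)} {Inf (snd j)<..<Sup (snd j)}) B"
        unfolding pairwise_def
      proof (intro ballI impI)
        fix i j assume "i \<in> B" "j \<in> B" "i \<noteq> j"
        then show "disjnt {Inf (snd i)<..<Sup (snd i)} {Inf (snd j)<..<Sup (snd j)}"
          using disj[of "fst i" "snd i" "fst j" "snd j"] by (auto simp: B_def disjnt_def)
      qed
    qed auto
    also have "\<dots> \<le> measure lebesgue U"
    proof (rule measure_mono_fmeasurable)
      show "(\<Union>b\<in>B. {Inf (snd b)<..<Sup (snd b)}) \<subseteq> U"
      proof (clarify)
        fix t x K assume "(x, K) \<in> B" "t \<in> {Inf (snd (x, K))<..<Sup (snd (x, K))}"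
        then have "t \<in> ball x (d x)" "x \<in> N" using K(2,3,5,6)[of x K] by (auto simp: B_def dist_real_def)
        then show "t \<in> U" using dN by blast
      qed
    qed (use Um \<open>finite B\<close> in auto)
    finally have "(\<Sum>(s, t)\<in>\<phi> ` B. norm (f t - f s)) < e"
      using U\<delta> \<open>finite B\<close> D pw by (intro \<delta>) auto
    then have bad: "(\<Sum>(x, K)\<in>B. norm (f (Sup K) - f (Inf K))) < e"
      by (subst (asm) sum.reindex[OF inj]) (simp add: \<phi>_def case_prod_unfold)
    \<comment> \<open>The increment telescopes over the tagged division and is then estimated tag by
      tag.\<close>
    have "f b - f a = (\<Sum>(x, K)\<in>P. f (Sup K) - f (Inf K))"
      using additive_tagged_division_1[OF ab, of P f] P by simp
    also have "\<dots> \<le> (\<Sum>(x, K)\<in>P. e * (Sup K - Inf K) +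
        (if (x, K) \<in> B then norm (f (Sup K) - f (Inf K)) else 0))"
    proof (rule sum_mono, clarify)
      fix x K assume xK: "(x, K) \<in> P"
      show "f (Sup K) - f (Inf K) \<le> e * (Sup K - Inf K) +
        (if (x, K) \<in> B then norm (f (Sup K) - f (Inf K)) else 0)"
      proof (cases "x \<in> N")
        case True
        show ?thesis
        proof (cases "Inf K < Sup K")
          case t: True
          then have "(x, K) \<in> B" using True xK by (simp add: B_def)
          moreover have "0 \<le> e * (Sup K - Inf K)" using t \<open>e > 0\<close> by simp
          ultimately show ?thesis by auto
        next
          case False
          then have "Inf K = Sup K" using K(2,3)[OF xK] by linarith
          then show ?thesis by simp
        qed
      next
        case False
        then have "f (Sup K) - f (Inf K) \<le> e * (Sup K - Inf K)"
          using K(1-6)[OF xK] by (intro dS[of x]) auto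
        then show ?thesis using False by (auto simp: B_def)
      qed
    qed
    also have "\<dots> = e * (\<Sum>(x, K)\<in>P. Sup K - Inf K) + (\<Sum>z\<in>P. if z \<in> B then norm (f (Sup (snd z)) - f (Inf (snd z))) else 0)"
      by (simp add: sum.distrib case_prod_unfold sum_distrib_left)
    also have "(\<Sum>(x, K)\<in>P. Sup K - Inf K) = b - a"
      using additive_tagged_division_1[OF ab, of P "\<lambda>x. x"] P by simp
    also have "(\<Sum>z\<in>P. if z \<in> B then norm (f (Sup (snd z)) - f (Inf (snd z))) else 0)
        = (\<Sum>z\<in>B. norm (f (Sup (snd z)) - f (Inf (snd z))))"
      using PD(1) \<open>B \<subseteq> P\<close> by (simp add: sum.inter_restrict[symmetric] Int_absorb1)
    finally show ?thesis using bad by (simp add: case_prod_unfold)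
  qed
  show ?thesis
  proof (rule ccontr)
    assume "\<not> f b \<le> f a"
    define c where "c = f b - f a"
    have "c > 0" using \<open>\<not> f b \<le> f a\<close> by (simp add: c_def)
    \<comment> \<open>With this choice the bound equals \<open>c / 2\<close>, contradicting an
      increment of \<open>c\<close>.\<close>
    define e where "e = c / (2 * (b - a + 1))"
    have "e > 0" using \<open>c > 0\<close> ab by (simp add: e_def)
    have "e * (b - a) + e = e * (b - a + 1)" by (simp add: algebra_simps)
    also have "\<dots> = c / 2" using ab by (simp add: e_def field_simps)
    finally show False using *[OF \<open>e > 0\<close>] \<open>c > 0\<close> by (simp add: c_def)
  qed
qed

section \<open>The least eigenvalue of a symmetric matrix\<close>

lemma inner_symmetric_matrix:
  fixes A :: "real^'n^'n"
  assumes "transpose A = A"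
  shows "(A *v x) \<bullet> y = x \<bullet> (A *v y)"
  using dot_lmul_matrix[of x A y] vector_transpose_matrix[of x A] assms by simp

text \<open>Eigenvectors for distinct eigenvalues are orthogonal, so one for each eigenvalue gives
  an independent set. Finiteness makes the \<open>Min\<close> in \<open>min_eigenvalue\<close>
  meaningful.\<close>

lemma eigenvalues_finite:
  fixes A :: "real^'n^'n"
  assumes sym: "transpose A = A"
  shows "finite {c. \<exists>v. v \<noteq> 0 \<and> A *v v = c *\<^sub>R v}" (is "finite ?E")
proof -
  have "\<forall>c\<in>?E. \<exists>v. v \<noteq> 0 \<and> A *v v = c *\<^sub>R v" by blast
  then obtain g where g: "\<And>c. c \<in> ?E \<Longrightarrow> g c \<noteq> 0 \<and> A *v g c = c *\<^sub>R g c"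
    by (metis (no_types, lifting) mem_Collect_eq)
  have orth: "orthogonal (g c) (g c')" if "c \<in> ?E" "c' \<in> ?E" "c \<noteq> c'" for c c'
  proof -
    have "c * (g c \<bullet> g c') = (A *v g c) \<bullet> g c'" using g[OF that(1)] by simp
    also have "\<dots> = g c \<bullet> (A *v g c')"
      by (rule inner_symmetric_matrix[OF sym])
    also have "\<dots> = c' * (g c \<bullet> g c')" using g[OF that(2)] by simp
    finally show ?thesis using that(3) by (simp add: orthogonal_def)
  qed
  have "inj_on g ?E"
  proof (rule inj_onI, rule ccontr)
    fix c c' assume "c \<in> ?E" "c' \<in> ?E" "g c = g c'" "c \<noteq> c'"
    then show False using orth[of c c'] g[of c'] by (simp add: orthogonal_self)
  qed
  moreover have "finite (g ` ?E)"
  proof (rule independent_imp_finite, rule pairwise_orthogonal_independent)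
    show "pairwise orthogonal (g ` ?E)" using orth by (auto simp: pairwise_def)
    show "0 \<notin> g ` ?E" using g by force
  qed
  ultimately show ?thesis by (simp add: finite_image_iff)
qed

text \<open>If \<open>A *v v\<close> were nonzero, a small step from \<open>v\<close> against it
  would make the form negative: the first-order decrease beats the quadratic remainder.\<close>

lemma psd_form_zero_imp_kernel:
  fixes A :: "real^'n^'n"
  assumes sym: "transpose A = A" and psd: "\<And>x. 0 \<le> x \<bullet> (A *v x)" and v: "v \<bullet> (A *v v) = 0"
  shows "A *v v = 0"
proof (rule ccontr)
  assume "A *v v \<noteq> 0"
  define u where "u = A *v v"
  define b where "b = u \<bullet> (A *v u)"
  have "u \<bullet> u > 0" using \<open>A *v v \<noteq> 0\<close> by (simp add: u_def)
  have "b \<ge> 0" using psd by (simp add: b_def)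
  \<comment> \<open>Small enough for \<open>t * b\<close> to stay below twice
    \<open>u \<bullet> u\<close>; the added one keeps the denominator positive when \<open>b\<close>
    vanishes.\<close>
  define t where "t = (u \<bullet> u) / (b + 1)"
  have "t > 0" using \<open>u \<bullet> u > 0\<close> \<open>b \<ge> 0\<close> by (simp add: t_def)
  have vAu: "v \<bullet> (A *v u) = u \<bullet> u"
    using inner_symmetric_matrix[OF sym, of v u] by (simp add: u_def)
  have "0 \<le> (v - t *\<^sub>R u) \<bullet> (A *v (v - t *\<^sub>R u))" by (rule psd)
  also have "\<dots> = v \<bullet> u - t * (v \<bullet> (A *v u)) - t * (u \<bullet> u) + t * t * b"
    by (simp add: matrix_vector_mult_diff_distrib matrix_vector_mult_scaleR inner_diff_left inner_diff_right
        u_def[symmetric] b_def algebra_simps)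
  also have "\<dots> = t * (t * b - 2 * (u \<bullet> u))"
    using v by (simp add: vAu algebra_simps u_def[symmetric])
  finally have "2 * (u \<bullet> u) \<le> t * b" using \<open>t > 0\<close> by (simp add: zero_le_mult_iff)
  moreover have "t * b \<le> t * (b + 1)" using \<open>t > 0\<close> by simp
  moreover have "t * (b + 1) = u \<bullet> u" using \<open>b \<ge> 0\<close> by (simp add: t_def)
  ultimately show False using \<open>u \<bullet> u > 0\<close> by linarith
qed

text \<open>The form attains a minimum \<open>\<mu>\<close> on the unit sphere. Then
  \<open>A - \<mu> *\<^sub>R mat 1\<close> is positive semidefinite with zero form at the minimizer,
  which is therefore an eigenvector; any other eigenvalue is a value of the Rayleigh quotient and so
  is at least \<open>\<mu>\<close>.\<close>

lemma min_eigenvalue_symmetric: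
  fixes A :: "real^'n^'n"
  assumes sym: "transpose A = A"
  shows min_eigenvalue_attained: "\<exists>v. v \<noteq> 0 \<and> A *v v = min_eigenvalue A *\<^sub>R v"
    and min_eigenvalue_le_form: "min_eigenvalue A * (x \<bullet> x) \<le> x \<bullet> (A *v x)"
proof -
  have "compact (sphere (0 :: real^'n) 1)" "sphere (0 :: real^'n) 1 \<noteq> {}" by auto
  moreover have "continuous_on (sphere 0 1) (\<lambda>x. x \<bullet> (A *v x))"
    by (intro continuous_intros linear_continuous_on matrix_vector_mul_bounded_linear)
  ultimately obtain v where v: "norm v = 1"
    and min: "\<And>x. norm x = 1 \<Longrightarrow> v \<bullet> (A *v v) \<le> x \<bullet> (A *v x)"
    using continuous_attains_inf[of "sphere 0 1" "\<lambda>x. x \<bullet> (A *v x)"] by auto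
  define \<mu> where "\<mu> = v \<bullet> (A *v v)"
  have ray: "\<mu> * (x \<bullet> x) \<le> x \<bullet> (A *v x)" for x
  proof (cases "x = 0")
    case False
    define y where "y = x /\<^sub>R norm x"
    have x: "x = norm x *\<^sub>R y" using False by (simp add: y_def)
    have "\<mu> \<le> y \<bullet> (A *v y)" unfolding \<mu>_def using False by (intro min) (simp add: y_def)
    then have "norm x * norm x * \<mu> \<le> norm x * norm x * (y \<bullet> (A *v y))" by (intro mult_left_mono) auto
    also have "\<dots> = x \<bullet> (A *v x)" by (subst (3 4) x) (simp add: matrix_vector_mult_scaleR)
    finally show ?thesis by (simp add: dot_square_norm power2_eq_square mult.commute)
  qed auto
  define B where "B = A - \<mu> *\<^sub>R mat 1"
  have B: "B *v x = A *v x - \<mu> *\<^sub>R x" for x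
    by (simp add: B_def matrix_vector_mult_diff_rdistrib scaleR_matrix_vector_assoc[symmetric])
  have "transpose B = B"
  proof -
    have "A $ i $ j = A $ j $ i" for i j using arg_cong[OF sym, of "\<lambda>M. M $ j $ i"] by (simp add: transpose_def)
    then show ?thesis by (simp add: B_def transpose_def vec_eq_iff mat_def)
  qed
  moreover have "0 \<le> x \<bullet> (B *v x)" for x using ray[of x] by (simp add: B inner_diff_right)
  moreover have "v \<bullet> (B *v v) = 0" using v by (simp add: B inner_diff_right \<mu>_def dot_square_norm)
  ultimately have "B *v v = 0" by (rule psd_form_zero_imp_kernel)
  then have \<mu>: "\<mu> \<in> {c. \<exists>v. v \<noteq> 0 \<and> A *v v = c *\<^sub>R v}" using v by (auto simp: B intro!: exI[of _ v])
  have "\<mu> \<le> c" if "v \<noteq> 0" "A *v v = c *\<^sub>R v" for c v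
    using ray[of v] that by simp
  with \<mu> have "min_eigenvalue A = \<mu>"
    unfolding min_eigenvalue_def by (intro Min_eqI eigenvalues_finite[OF sym]) auto
  then show "\<exists>v. v \<noteq> 0 \<and> A *v v = min_eigenvalue A *\<^sub>R v" "min_eigenvalue A * (x \<bullet> x) \<le> x \<bullet> (A *v x)"
    using \<mu> ray by auto
qed

section \<open>Filippov velocities of the closed loop\<close>

lemma proj_matrix_mult_vec: "proj_matrix g *v x = x - (g \<bullet> x) *\<^sub>R g"
  by (simp add: proj_matrix_def matrix_vector_mult_diff_rdistrib vec_eq_iff)
     (simp add: matrix_vector_mult_def inner_vec_def sum_distrib_left sum_distrib_right mult_ac)

lemma inner_proj_matrix: "x \<bullet> (proj_matrix g *v y) = (proj_matrix g *v x) \<bullet> y"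
  by (simp add: proj_matrix_mult_vec inner_diff_left inner_diff_right inner_commute)

text \<open>Reversing an edge changes the sign of its bearing but not the outer product of the
  bearing with itself.\<close>

lemma proj_matrix_bearing_commute: "proj_matrix (bearing p j i) = proj_matrix (bearing p i j)"
  by (simp add: proj_matrix_def bearing_def vec_eq_iff norm_minus_commute[of "p $ i"] mult_ac)
     (simp add: algebra_simps)

lemma displacement_commute: "displacement pstar p j i = - displacement pstar p i j"
  by (simp add: displacement_def proj_matrix_bearing_commute[of pstar i j]
      matrix_vector_mult_diff_distrib)

lemma displacement_diff: "displacement pstar (p - p') i j = displacement pstar p i j - displacement pstar p' i j"
  by (simp add: displacement_def matrix_vector_mult_diff_distrib)

text \<open>The projection annihilates the bearing direction. By linearity, the displacements of a
  configuration are therefore those of its error relative to the target.\<close>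

lemma displacement_self: "displacement pstar pstar i j = 0"
proof (cases "pstar $ i = pstar $ j")
  case False
  define u where "u = pstar $ j - pstar $ i"
  have "u \<noteq> 0" using False by (simp add: u_def)
  then have "(bearing pstar i j \<bullet> u) *\<^sub>R bearing pstar i j = u"
    by (simp add: bearing_def u_def[symmetric] dot_square_norm power2_eq_square field_simps)
  then have "proj_matrix (bearing pstar i j) *v u = 0" by (simp add: proj_matrix_mult_vec)
  moreover have "pstar $ i - pstar $ j = - u" by (simp add: u_def)
  ultimately show ?thesis
    using matrix_vector_mult_diff_distrib[of "proj_matrix (bearing pstar i j)" 0 u]
    by (simp add: displacement_def)
qed (simp add: displacement_def)

lemma bounded_linear_displacement: "bounded_linear (\<lambda>p. displacement pstar p i j)"
  unfolding displacement_def
  by (intro bounded_linear_compose[OF matrix_vector_mul_bounded_linear] bounded_linear_sub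
      bounded_linear_vec_nth)

lemma norm1_nonneg: "0 \<le> norm1 x"
  by (simp add: norm1_def sum_nonneg)

lemma norm_le_norm1: "norm x \<le> norm1 x"
  unfolding norm1_def by (rule norm_le_l1_cart)

lemma sgn_vec_minus: "sgn_vec (- x) = - sgn_vec x"
  by (simp add: sgn_vec_def vec_eq_iff sgn_minus)

text \<open>In a coordinate where \<open>q\<close> is nonzero the sign is continuous; where
  \<open>q\<close> is zero, the jumping sign is multiplied by zero.\<close>

lemma tendsto_inner_sgn_vec:
  assumes "(f \<longlongrightarrow> q) F"
  shows "((\<lambda>x. q \<bullet> sgn_vec (f x)) \<longlongrightarrow> norm1 q) F"
  unfolding inner_vec_def norm1_def sgn_vec_def
proof (rule tendsto_sum)
  fix c
  show "((\<lambda>x. q $ c \<bullet> (\<chi> c. sgn (f x $ c)) $ c) \<longlongrightarrow> \<bar>q $ c\<bar>) F"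
  proof (cases "q $ c = 0")
    case False
    have "((\<lambda>x. q $ c * sgn (f x $ c)) \<longlongrightarrow> q $ c * sgn (q $ c)) F"
      by (intro tendsto_mult tendsto_const tendsto_sgn tendsto_vec_nth assms False)
    then show ?thesis by (simp add: abs_sgn)
  qed simp
qed

section \<open>From sums over neighbors to sums over edges\<close>

lemma oriented_graph_src_neq_tgt: "oriented_graph E src tgt \<Longrightarrow> src k \<noteq> tgt k"
  by (force simp: oriented_graph_def bij_betw_def)

lemma edge_index_src_tgt:
  assumes "oriented_graph E src tgt"
  shows "edge_index src tgt (src k) (tgt k) = k" "edge_index src tgt (tgt k) (src k) = k"
proof -
  have "inj (\<lambda>k. {src k, tgt k})" using assms by (simp add: oriented_graph_def bij_betw_def)
  then have *: "k' = k" if "{src k', tgt k'} = {src k, tgt k}" for k' using that by (rule injD)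
  then show "edge_index src tgt (src k) (tgt k) = k" unfolding edge_index_def by (intro the_equality) auto
  show "edge_index src tgt (tgt k) (src k) = k"
    unfolding edge_index_def insert_commute[of "tgt k"] using * by (intro the_equality) auto
qed

text \<open>Each undirected edge is met once from either end. The adjacent ordered pairs thus split
  into the oriented edges \<open>S\<close> and their reversals \<open>T\<close>, disjoint because a
  common pair would force a loop.\<close>

lemma sum_neighbors:
  fixes h :: "'v::finite \<Rightarrow> 'v \<Rightarrow> 'b::comm_monoid_add"
  assumes G: "oriented_graph E src (tgt :: 'e::finite \<Rightarrow> 'v)"
  shows "(\<Sum>i\<in>UNIV. \<Sum>j\<in>neighbors E i. h i j) = (\<Sum>k\<in>UNIV. h (src k) (tgt k) + h (tgt k) (src k))"
proof -
  have E: "E = range (\<lambda>k. {src k, tgt k})" and inj: "inj (\<lambda>k. {src k, tgt k})"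
    using G by (auto simp: oriented_graph_def bij_betw_def)
  define S T where "S = range (\<lambda>k. (src k, tgt k))" and "T = range (\<lambda>k. (tgt k, src k))"
  have inj1: "inj (\<lambda>k. (src k, tgt k))" and inj2: "inj (\<lambda>k. (tgt k, src k))"
    using inj by (auto simp: inj_def)
  have "S \<inter> T = {}"
  proof -
    have False if "src k = tgt k'" "tgt k = src k'" for k k'
    proof -
      have "{src k, tgt k} = {src k', tgt k'}" using that by auto
      then have "k = k'" using inj by (simp add: inj_def)
      then show False using that oriented_graph_src_neq_tgt[OF G, of k] by simp
    qed
    then show ?thesis by (auto simp: S_def T_def)
  qed
  have "(SIGMA i:UNIV. neighbors E i) = S \<union> T"
    unfolding E neighbors_def S_def T_def by (auto simp: doubleton_eq_iff)
  then have "(\<Sum>i\<in>UNIV. \<Sum>j\<in>neighbors E i. h i j) = (\<Sum>(i, j)\<in>S \<union> T. h i j)"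
    by (subst sum.Sigma) auto
  also have "\<dots> = (\<Sum>(i, j)\<in>S. h i j) + (\<Sum>(i, j)\<in>T. h i j)"
    using \<open>S \<inter> T = {}\<close> by (intro sum.union_disjoint) (auto simp: S_def T_def)
  also have "\<dots> = (\<Sum>k\<in>UNIV. h (src k) (tgt k)) + (\<Sum>k\<in>UNIV. h (tgt k) (src k))"
    unfolding S_def T_def by (simp add: sum.reindex[OF inj1] sum.reindex[OF inj2])
  finally show ?thesis by (simp add: sum.distrib)
qed

text \<open>The two ends of an edge share a gain and a projection and see opposite signs, so they
  combine into a difference; self-adjointness moves the projection onto \<open>z\<close>. Keeping
  \<open>z\<close> independent of \<open>p\<close> allows the error to be frozen while
  \<open>p\<close> varies.\<close>

lemma sum_inner_control:
  assumes G: "oriented_graph E src (tgt :: 'e::finite \<Rightarrow> 'v::finite)"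
  shows "(\<Sum>i\<in>UNIV. z $ i \<bullet> control pstar E src tgt p \<gamma> i) =
    - (\<Sum>k\<in>UNIV. \<gamma> $ k * (displacement pstar z (src k) (tgt k) \<bullet>
        sgn_vec (displacement pstar p (src k) (tgt k))))"
proof -
  define h where "h i j = \<gamma> $ edge_index src tgt i j * (z $ i \<bullet>
      (proj_matrix (bearing pstar i j) *v sgn_vec (displacement pstar p i j)))" for i j
  have "(\<Sum>i\<in>UNIV. z $ i \<bullet> control pstar E src tgt p \<gamma> i) = - (\<Sum>i\<in>UNIV. \<Sum>j\<in>neighbors E i. h i j)"
    by (simp add: control_def h_def inner_sum_right sum_negf)
  also have "(\<Sum>i\<in>UNIV. \<Sum>j\<in>neighbors E i. h i j) = (\<Sum>k\<in>UNIV. h (src k) (tgt k) + h (tgt k) (src k))"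
    by (rule sum_neighbors[OF G])
  also have "\<dots> = (\<Sum>k\<in>UNIV. \<gamma> $ k * (displacement pstar z (src k) (tgt k) \<bullet>
        sgn_vec (displacement pstar p (src k) (tgt k))))"
  proof (rule sum.cong[OF refl])
    fix k
    define P where "P = proj_matrix (bearing pstar (src k) (tgt k))"
    define s where "s = sgn_vec (displacement pstar p (src k) (tgt k))"
    have "h (src k) (tgt k) + h (tgt k) (src k) = \<gamma> $ k * (z $ src k \<bullet> (P *v s)) + \<gamma> $ k * (z $ tgt k \<bullet> (P *v (- s)))"
      by (simp add: h_def edge_index_src_tgt[OF G] displacement_commute[of pstar p "tgt k" "src k"]
          proj_matrix_bearing_commute[of pstar "tgt k" "src k"] sgn_vec_minus P_def s_def)
    also have "\<dots> = \<gamma> $ k * ((P *v (z $ src k - z $ tgt k)) \<bullet> s)"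
      unfolding P_def inner_proj_matrix
      by (simp add: matrix_vector_mult_diff_distrib inner_diff_left inner_diff_right algebra_simps)
    finally show "h (src k) (tgt k) + h (tgt k) (src k) = \<gamma> $ k * (displacement pstar z (src k) (tgt k) \<bullet>
        sgn_vec (displacement pstar p (src k) (tgt k)))"
      by (simp add: displacement_def P_def s_def)
  qed
  finally show ?thesis .
qed

text \<open>A functional of the field that converges at \<open>x\<close> takes only values near
  \<open>c\<close> on a small ball. Preimages of closed balls are closed and convex, so the closed
  convex hull inherits this bound.\<close>

lemma filippov_map_functional:
  assumes v: "v \<in> filippov_map F t x" and \<phi>: "bounded_linear \<phi>"
    and lim: "((\<lambda>y. \<phi> (F t y)) \<longlongrightarrow> (c :: real)) (nhds x)"
  shows "\<phi> v = c"
proof (rule ccontr)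
  assume "\<phi> v \<noteq> c"
  define \<eta> where "\<eta> = \<bar>\<phi> v - c\<bar> / 2"
  have "\<eta> > 0" using \<open>\<phi> v \<noteq> c\<close> by (simp add: \<eta>_def)
  then have "\<forall>\<^sub>F y in nhds x. dist (\<phi> (F t y)) c < \<eta>" using lim by (simp add: tendsto_iff)
  then obtain \<epsilon> where "\<epsilon> > 0" and \<epsilon>: "\<And>y. dist y x < \<epsilon> \<Longrightarrow> dist (\<phi> (F t y)) c < \<eta>"
    by (auto simp: eventually_nhds_metric)
  define H where "H = \<phi> -` cball c \<eta>"
  interpret bounded_linear \<phi> by fact
  have "closed H" unfolding H_def by (intro continuous_closed_vimage linear_continuous_at \<phi> closed_cball)
  moreover have "convex H" unfolding H_def
    by (intro convex_linear_vimage convex_cball linear_axioms)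
  \<comment> \<open>The empty set serves as the exceptional null set. The ball then keeps its
    center, which is why the limit is taken along \<open>nhds x\<close>.\<close>
  moreover have "F t ` (ball x \<epsilon> - {}) \<subseteq> H"
    using \<epsilon> by (auto simp: H_def dist_commute less_imp_le)
  ultimately have "closure (convex hull (F t ` (ball x \<epsilon> - {}))) \<subseteq> H"
    by (intro closure_minimal hull_minimal)
  moreover have "v \<in> closure (convex hull (F t ` (ball x \<epsilon> - {})))"
    using v \<open>\<epsilon> > 0\<close> unfolding filippov_map_def by blast
  ultimately have "\<bar>\<phi> v - c\<bar> \<le> \<eta>" by (auto simp: H_def dist_real_def)
  then show False using \<open>\<eta> > 0\<close> by (simp add: \<eta>_def)
qed

lemma sum_UNIV_Plus:
  "(\<Sum>i\<in>UNIV. h i) = (\<Sum>a\<in>UNIV. h (Inl a)) + (\<Sum>b\<in>UNIV. h (Inr b))"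
  for h :: "'l::finite + 'f::finite \<Rightarrow> 'b::comm_monoid_add"
  by (simp add: UNIV_Plus_UNIV[symmetric] sum.Plus del: UNIV_Plus_UNIV)

lemma tendsto_with_leaders:
  assumes "(f \<longlongrightarrow> y) F"
  shows "((\<lambda>x. with_leaders pstar (f x)) \<longlongrightarrow> with_leaders pstar y) F"
  unfolding with_leaders_def
  by (intro tendsto_vec_lambda) (auto split: sum.split intro!: tendsto_intros tendsto_vec_nth assms)

text \<open>The velocity set itself may be large, but its pairing with the error at \<open>x\<close>
  and its gain components are single-valued, since these functionals of the right-hand side are
  continuous at \<open>x\<close>.\<close>

lemma filippov_map_closed_loop:
  fixes pstar :: "real^'d^('l::finite + 'f::finite)"
  assumes G: "oriented_graph E src tgt"
    and v: "v \<in> filippov_map (closed_loop pstar E src tgt \<kappa> w) t x"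
  defines "z \<equiv> with_leaders pstar (fst x) - pstar"
  shows "(fst x - (\<chi> i. pstar $ Inr i)) \<bullet> fst v =
      - (\<Sum>k\<in>UNIV. snd x $ k * norm1 (displacement pstar z (src k) (tgt k))) + z \<bullet> w t"
    and "snd v $ k = \<kappa> * norm1 (displacement pstar z (src k) (tgt k))"
proof -
  let ?F = "closed_loop pstar E src tgt \<kappa> w"
  have lim: "((\<lambda>y. displacement pstar (with_leaders pstar (fst y)) i j) \<longlongrightarrow> displacement pstar z i j) (nhds x)"
    for i j
  proof -
    have "displacement pstar z i j = displacement pstar (with_leaders pstar (fst x)) i j"
      by (simp add: z_def displacement_diff displacement_self)
    then show ?thesis
      by (simp only:)
         (intro bounded_linear.tendsto[OF bounded_linear_displacement] tendsto_with_leaders tendsto_fst filterlim_ident)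
  qed
  have zl: "z $ Inl a = 0" for a by (simp add: z_def with_leaders_def)
  have zr: "z $ Inr b = fst x $ b - pstar $ Inr b" for b by (simp add: z_def with_leaders_def)
  \<comment> \<open>The error stays at the state \<open>x\<close> while the field is evaluated at a
    nearby \<open>y\<close>. The leader terms may be added because \<open>z\<close> vanishes
    there.\<close>
  have "(fst x - (\<chi> i. pstar $ Inr i)) \<bullet> fst (?F t y) =
      - (\<Sum>k\<in>UNIV. snd y $ k * (displacement pstar z (src k) (tgt k) \<bullet>
          sgn_vec (displacement pstar (with_leaders pstar (fst y)) (src k) (tgt k)))) + z \<bullet> w t" for y
  proof -
    have "(fst x - (\<chi> i. pstar $ Inr i)) \<bullet> fst (?F t y) =
      (\<Sum>i\<in>UNIV. z $ i \<bullet> (control pstar E src tgt (with_leaders pstar (fst y)) (snd y) i + w t $ i))"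
      unfolding sum_UNIV_Plus by (simp add: zl zr closed_loop_def Let_def inner_vec_def[of "fst x - _"])
    also have "\<dots> = (\<Sum>i\<in>UNIV. z $ i \<bullet> control pstar E src tgt (with_leaders pstar (fst y)) (snd y) i) + z \<bullet> w t"
      by (simp add: inner_add_right sum.distrib inner_vec_def[of z])
    finally show ?thesis by (simp add: sum_inner_control[OF G])
  qed
  moreover have "((\<lambda>y. - (\<Sum>k\<in>UNIV. snd y $ k * (displacement pstar z (src k) (tgt k) \<bullet>
          sgn_vec (displacement pstar (with_leaders pstar (fst y)) (src k) (tgt k)))) + z \<bullet> w t) \<longlongrightarrow>
      - (\<Sum>k\<in>UNIV. snd x $ k * norm1 (displacement pstar z (src k) (tgt k))) + z \<bullet> w t) (nhds x)"
    by (intro tendsto_intros tendsto_inner_sgn_vec lim tendsto_vec_nth tendsto_snd filterlim_ident)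
  ultimately show "(fst x - (\<chi> i. pstar $ Inr i)) \<bullet> fst v =
      - (\<Sum>k\<in>UNIV. snd x $ k * norm1 (displacement pstar z (src k) (tgt k))) + z \<bullet> w t"
    by (intro filippov_map_functional[OF v])
       (auto intro!: bounded_linear_compose[OF bounded_linear_inner_right] bounded_linear_fst)
  have "((\<lambda>y. \<kappa> * norm1 (displacement pstar (with_leaders pstar (fst y)) (src k) (tgt k))) \<longlongrightarrow>
      \<kappa> * norm1 (displacement pstar z (src k) (tgt k))) (nhds x)"
    unfolding norm1_def by (intro tendsto_intros tendsto_vec_nth lim)
  then show "snd v $ k = \<kappa> * norm1 (displacement pstar z (src k) (tgt k))"
    by (intro filippov_map_functional[OF v])
       (auto simp: closed_loop_def Let_def intro!: bounded_linear_compose[OF bounded_linear_vec_nth] bounded_linear_snd)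
qed

section \<open>Rigidity and the follower block\<close>

definition stack :: "real^'d::finite^'v::finite \<Rightarrow> real^('v \<times> 'd)" where
  "stack z = (\<chi> r. z $ fst r $ snd r)"

lemma stack_eq_iff: "stack y = stack z \<longleftrightarrow> y = z"
  by (simp add: stack_def vec_eq_iff)

lemma sum_UNIV_pair:
  "(\<Sum>r\<in>UNIV. h r) = (\<Sum>a\<in>UNIV. \<Sum>b\<in>UNIV. h (a, b))"
  for h :: "'a::finite \<times> 'b::finite \<Rightarrow> 'c::comm_monoid_add"
  by (simp add: sum.cartesian_product UNIV_Times_UNIV)

lemma inner_stack: "stack y \<bullet> stack z = y \<bullet> z"
  by (simp add: stack_def inner_vec_def sum_UNIV_pair)

lemma blkdiag_mult_vec: "(blkdiag B *v u) $ (k, a) = (B k *v (\<chi> b. u $ (k, b))) $ a"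
proof -
  have "(blkdiag B *v u) $ (k, a) =
      (\<Sum>b\<in>UNIV. \<Sum>j\<in>UNIV. if k = j then B k $ a $ b * u $ (j, b) else 0)"
    by (subst sum.swap) (auto simp: blkdiag_def matrix_vector_mult_def sum_UNIV_pair intro!: sum.cong)
  then show ?thesis by (simp add: matrix_vector_mult_def)
qed

lemma kronecker_mat1_mult_stack:
  "(kronecker A (mat 1) *v stack z) $ (k, b) = (\<Sum>i\<in>UNIV. A $ k $ i * z $ i $ b)"
  by (simp add: kronecker_def stack_def matrix_vector_mult_def sum_UNIV_pair mat_def
      if_distrib[of "\<lambda>x. _ * x"] if_distrib[of "\<lambda>x. x * _"] sum.delta' cong: if_cong)

text \<open>The minus sign arises because the incidence matrix takes target minus source, whereas
  displacements take source minus target.\<close>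

lemma rigidity_matrix_mult_stack:
  assumes "oriented_graph E src tgt"
  shows "bearing_rigidity_matrix src tgt pstar *v stack z =
    stack (\<chi> k. - displacement pstar z (src k) (tgt k))"
proof -
  have inc: "(\<Sum>i\<in>UNIV. incidence_matrix src tgt $ k $ i * z $ i $ b) = z $ tgt k $ b - z $ src k $ b" for k b
  proof -
    have "incidence_matrix src tgt $ k $ i * z $ i $ b =
        (if i = tgt k then z $ i $ b else 0) - (if i = src k then z $ i $ b else 0)" for i
      using oriented_graph_src_neq_tgt[OF assms, of k] by (auto simp: incidence_matrix_def)
    then show ?thesis by (simp add: sum_subtractf)
  qed
  have "(bearing_rigidity_matrix src tgt pstar *v stack z) $ (k, a) = (- displacement pstar z (src k) (tgt k)) $ a" for k a
  proof -
    have "(bearing_rigidity_matrix src tgt pstar *v stack z) $ (k, a) =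
      (proj_matrix (bearing pstar (src k) (tgt k)) *v (z $ tgt k - z $ src k)) $ a"
      unfolding bearing_rigidity_matrix_def matrix_vector_mul_assoc[symmetric] blkdiag_mult_vec
        kronecker_mat1_mult_stack inc
      by (simp add: minus_vec_def)
    then show ?thesis by (simp add: displacement_def matrix_vector_mult_diff_distrib)
  qed
  then show ?thesis by (simp add: vec_eq_iff stack_def split_paired_all)
qed

lemma bearing_laplacian_form:
  assumes "oriented_graph E src tgt"
  shows "stack z \<bullet> (bearing_laplacian src tgt pstar *v stack z) =
    (\<Sum>k\<in>UNIV. (norm (displacement pstar z (src k) (tgt k)))\<^sup>2)"
proof -
  let ?R = "bearing_rigidity_matrix src tgt pstar"
  have "stack z \<bullet> (bearing_laplacian src tgt pstar *v stack z) = (?R *v stack z) \<bullet> (?R *v stack z)"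
    unfolding bearing_laplacian_def matrix_vector_mul_assoc[symmetric] dot_lmul_matrix[symmetric]
    by (simp add: vector_transpose_matrix)
  then show ?thesis
    unfolding rigidity_matrix_mult_stack[OF assms] inner_stack
    by (simp add: inner_vec_def power2_norm_eq_inner)
qed

lemma transpose_bearing_laplacian: "transpose (bearing_laplacian src tgt pstar) = bearing_laplacian src tgt pstar"
  by (simp add: bearing_laplacian_def matrix_transpose_mul)

lemma transpose_follower_block: "transpose L = L \<Longrightarrow> transpose (follower_block L) = follower_block L"
  by (simp add: follower_block_def transpose_def vec_eq_iff)

text \<open>With zero leader coordinates, only the follower-follower terms of the quadratic form
  survive.\<close>

lemma follower_block_form:
  fixes z :: "real^'d::finite^('l::finite + 'f::finite)"
  assumes "\<And>a. z $ Inl a = 0"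
  shows "stack (\<chi> b. z $ Inr b) \<bullet> (follower_block L *v stack (\<chi> b. z $ Inr b)) = stack z \<bullet> (L *v stack z)"
  by (simp add: inner_vec_def matrix_vector_mult_def sum_UNIV_pair sum_UNIV_Plus stack_def
      follower_block_def assms)

text \<open>Translations and scalings of the target always lie in the kernel of the rigidity matrix.
  They form a space of dimension \<open>CARD('d) + 1\<close>, which rigidity makes the dimension of
  the whole kernel.\<close>

lemma rigid_kernel:
  fixes z :: "real^'d::finite^'v::finite"
  assumes G: "oriented_graph E src tgt" and rigid: "infinitesimally_bearing_rigid src tgt pstar"
    and ij: "pstar $ i \<noteq> pstar $ j"
    and ker: "\<And>k. displacement pstar z (src k) (tgt k) = 0"
  obtains c s where "\<And>i. z $ i = c + s *\<^sub>R pstar $ i"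
proof -
  let ?R = "bearing_rigidity_matrix src tgt pstar"
  \<comment> \<open>The kernel, written as the orthogonal complement of the row space to match the
    dimension formula.\<close>
  define K where "K = {y \<in> UNIV. \<forall>x \<in> span (rows ?R). orthogonal x y}"
  have inK: "stack y \<in> K" if "\<And>k. displacement pstar y (src k) (tgt k) = 0" for y
  proof -
    have "?R *v stack y = 0"
      unfolding rigidity_matrix_mult_stack[OF G] that by (simp add: stack_def vec_eq_iff)
    then have "?R $ r \<bullet> stack y = 0" for r by (simp flip: matrix_vector_mul_component)
    then have "orthogonal (stack y) x" if "x \<in> rows ?R" for x
      using that by (auto simp: rows_def row_def orthogonal_def inner_commute)
    then have "orthogonal (stack y) x" if "x \<in> span (rows ?R)" for x
      using that orthogonal_to_span by blast
    then show ?thesis by (auto simp: K_def orthogonal_commute)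
  qed
  have "dim K + dim (span (rows ?R)) = dim (UNIV :: (real^('v \<times> 'd)) set)"
    unfolding K_def by (rule dim_subspace_orthogonal_to_vectors) auto
  then have "dim K + rank ?R = CARD('v) * CARD('d)"
    by (simp add: row_rank_def)
  then have dimK: "dim K = CARD('d) + 1"
    using rigid unfolding infinitesimally_bearing_rigid_def
    by (simp add: mult.commute flip: of_nat_mult)
  define \<phi> :: "(real^'d) \<times> real \<Rightarrow> real^('v \<times> 'd)" where
    "\<phi> = (\<lambda>(c, s). stack (\<chi> i. c + s *\<^sub>R pstar $ i))"
  have lin: "linear \<phi>"
    by (rule linearI) (auto simp: \<phi>_def stack_def vec_eq_iff algebra_simps)
  \<comment> \<open>Two distinct target points separate scaling from translation.\<close>
  have inj: "inj \<phi>"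
  proof (rule injI, clarify)
    fix c s c' s' assume "\<phi> (c, s) = \<phi> (c', s')"
    then have eq: "(\<chi> i. c + s *\<^sub>R pstar $ i) = (\<chi> i. c' + s' *\<^sub>R pstar $ i)"
      by (simp add: \<phi>_def stack_eq_iff)
    have *: "c + s *\<^sub>R pstar $ i = c' + s' *\<^sub>R pstar $ i" for i
      using arg_cong[OF eq, of "\<lambda>v. v $ i"] by simp
    have "(s - s') *\<^sub>R (pstar $ i - pstar $ j) =
        ((c + s *\<^sub>R pstar $ i) - (c' + s' *\<^sub>R pstar $ i)) - ((c + s *\<^sub>R pstar $ j) - (c' + s' *\<^sub>R pstar $ j))"
      by (simp add: algebra_simps)
    then have "(s - s') *\<^sub>R (pstar $ i - pstar $ j) = 0" using * by simp
    then have "s = s'" using ij by simp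
    then show "c = c' \<and> s = s'" using *[of i] by simp
  qed
  have "range \<phi> = K"
  proof (rule subspace_dim_equal)
    show "subspace (range \<phi>)" using lin by (simp add: linear_subspace_image)
    show "subspace K"
      unfolding K_def by (simp add: subspace_orthogonal_to_vectors)
    show "range \<phi> \<subseteq> K"
    proof clarify
      fix c s
      have "displacement pstar (\<chi> i. c + s *\<^sub>R pstar $ i) i j = s *\<^sub>R displacement pstar pstar i j" for i j
        by (simp add: displacement_def matrix_vector_mult_scaleR flip: scaleR_diff_right)
      then show "\<phi> (c, s) \<in> K" by (simp add: \<phi>_def inK displacement_self)
    qed
    have "dim (range \<phi>) = dim (UNIV :: ((real^'d) \<times> real) set)"
      by (rule dim_image_eq[OF lin]) (use inj in simp)
    then show "dim K \<le> dim (range \<phi>)" by (simp add: dimK)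
  qed
  then have "stack z \<in> range \<phi>" using inK ker by blast
  then obtain c s where "stack z = stack (\<chi> i. c + s *\<^sub>R pstar $ i)"
    by (auto simp: \<phi>_def)
  then have "z $ i = c + s *\<^sub>R pstar $ i" for i by (simp add: stack_eq_iff)
  then show thesis by (rule that)
qed

text \<open>Two distinct leader positions fix both the translation and the scaling left free by rigidity.\<close>

lemma min_eigenvalue_follower_block:
  fixes pstar :: "real^'d::finite^('l::finite + 'f::finite)"
  assumes G: "oriented_graph E src tgt" and rigid: "infinitesimally_bearing_rigid src tgt pstar"
    and inj: "inj (\<lambda>i. pstar $ i)" and "CARD('l) \<ge> 2"
  defines "\<mu> \<equiv> min_eigenvalue (follower_block (bearing_laplacian src tgt pstar))"
  shows min_eigenvalue_follower_block_pos: "\<mu> > 0"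
    and min_eigenvalue_follower_block_le: "\<And>z. (\<And>a. z $ Inl a = 0) \<Longrightarrow>
      \<mu> * (norm z)\<^sup>2 \<le> (\<Sum>k\<in>UNIV. (norm (displacement pstar z (src k) (tgt k)))\<^sup>2)"
proof -
  let ?L = "follower_block (bearing_laplacian src tgt pstar)"
  note sym = transpose_follower_block[OF transpose_bearing_laplacian[of src tgt pstar]]
  have form: "stack (\<chi> b. z $ Inr b) \<bullet> (?L *v stack (\<chi> b. z $ Inr b)) =
      (\<Sum>k\<in>UNIV. (norm (displacement pstar z (src k) (tgt k)))\<^sup>2)" if "\<And>a. z $ Inl a = 0" for z
    using that by (simp add: follower_block_form bearing_laplacian_form[OF G])
  show "\<mu> * (norm z)\<^sup>2 \<le> (\<Sum>k\<in>UNIV. (norm (displacement pstar z (src k) (tgt k)))\<^sup>2)"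
    if "\<And>a. z $ Inl a = 0" for z
  proof -
    have "(norm z)\<^sup>2 = stack (\<chi> b. z $ Inr b) \<bullet> stack (\<chi> b. z $ Inr b)"
      by (simp add: inner_stack power2_norm_eq_inner) (simp add: inner_vec_def sum_UNIV_Plus that)
    then show ?thesis
      using min_eigenvalue_le_form[OF sym, of "stack (\<chi> b. z $ Inr b)"] form[of z] that
      by (simp add: \<mu>_def)
  qed
  obtain a b :: 'l where "a \<noteq> b"
  proof -
    have "\<not> card (UNIV :: 'l set) \<le> Suc 0" using \<open>CARD('l) \<ge> 2\<close> by simp
    then show ?thesis using that by (auto simp: card_le_Suc0_iff_eq)
  qed
  then have ab: "pstar $ Inl a \<noteq> pstar $ Inl b" using inj by (auto simp: inj_def)
  obtain v where v: "v \<noteq> 0" "?L *v v = \<mu> *\<^sub>R v"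
    using min_eigenvalue_attained[OF sym] unfolding \<mu>_def by blast
  \<comment> \<open>An eigenvector for the least eigenvalue, extended by zero to the leaders. If all
    its displacements vanished, it would be a translated scaling of the target that is zero at two
    distinct points, hence zero.\<close>
  define z :: "real^'d^('l + 'f)" where "z = (\<chi> i. case i of Inl a \<Rightarrow> 0 | Inr b \<Rightarrow> \<chi> c. v $ (b, c))"
  have zl: "z $ Inl a = 0" for a by (simp add: z_def)
  have vz: "v = stack (\<chi> b. z $ Inr b)" by (simp add: z_def stack_def vec_eq_iff split_paired_all)
  have eq: "\<mu> * (v \<bullet> v) = (\<Sum>k\<in>UNIV. (norm (displacement pstar z (src k) (tgt k)))\<^sup>2)"
    using form[of z] zl v by (simp flip: vz)
  have "(\<Sum>k\<in>UNIV. (norm (displacement pstar z (src k) (tgt k)))\<^sup>2) \<noteq> 0"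
  proof
    assume "(\<Sum>k\<in>UNIV. (norm (displacement pstar z (src k) (tgt k)))\<^sup>2) = 0"
    then have "displacement pstar z (src k) (tgt k) = 0" for k by (simp add: sum_nonneg_eq_0_iff)
    then obtain c s where *: "\<And>i. z $ i = c + s *\<^sub>R pstar $ i"
      using rigid_kernel[OF G rigid ab] by blast
    have "s *\<^sub>R (pstar $ Inl a - pstar $ Inl b) = z $ Inl a - z $ Inl b"
      by (simp add: * scaleR_diff_right)
    then have "s *\<^sub>R (pstar $ Inl a - pstar $ Inl b) = 0" using zl by simp
    then have "s = 0" using ab by simp
    then have "c = 0" using *[of "Inl a"] zl by simp
    then have "z = 0" using * \<open>s = 0\<close> by (simp add: vec_eq_iff)
    then show False using v(1) vz by (simp add: stack_def vec_eq_iff)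
  qed
  then have "\<mu> * (v \<bullet> v) > 0" unfolding eq by (simp add: less_le sum_nonneg)
  then show "\<mu> > 0" using v(1) zero_less_mult_pos2[of \<mu> "v \<bullet> v"] by simp
qed

section \<open>Convergence of the adaptive dynamics\<close>

lemma inner_self_diff_le:
  assumes "norm x \<le> M" "norm y \<le> M"
  shows "\<bar>x \<bullet> x - y \<bullet> y\<bar> \<le> 2 * M * norm (x - y)"
proof -
  have "x \<bullet> x - y \<bullet> y = (x + y) \<bullet> (x - y)"
    by (simp add: inner_diff_right inner_add_left inner_commute[of y x])
  also have "\<bar>\<dots>\<bar> \<le> norm (x + y) * norm (x - y)" by (rule Cauchy_Schwarz_ineq2)
  also have "norm (x + y) \<le> 2 * M" using norm_triangle_ineq[of x y] assms by linarith
  finally show ?thesis by (simp add: mult_right_mono)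
qed

text \<open>One parametrized family covers the squared error, the quadratic and linear gain terms,
  and a time drift, so each later estimate is a choice of coefficients.\<close>

lemma quadratic_lyapunov_nonincreasing:
  fixes z :: "real \<Rightarrow> 'a::euclidean_space" and \<gamma> :: "real \<Rightarrow> 'b::euclidean_space"
  assumes ab: "a \<le> b" and ac: "absolutely_continuous_on_interval a b (\<lambda>t. (z t, \<gamma> t))"
    and N: "negligible N"
    and deriv: "\<And>t. \<lbrakk>t \<in> {a..b}; t \<notin> N\<rbrakk> \<Longrightarrow> \<exists>v g. ((\<lambda>t. (z t, \<gamma> t)) has_vector_derivative (v, g)) (at t within {a..b}) \<and>
        2 * \<alpha> * (z t \<bullet> v) + 2 * \<mu> * (\<gamma> t \<bullet> g) + \<nu> \<bullet> g + \<tau> \<le> 0"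
  shows "\<alpha> * (z b \<bullet> z b) + \<mu> * (\<gamma> b \<bullet> \<gamma> b) + \<nu> \<bullet> \<gamma> b + \<tau> * b \<le>
      \<alpha> * (z a \<bullet> z a) + \<mu> * (\<gamma> a \<bullet> \<gamma> a) + \<nu> \<bullet> \<gamma> a + \<tau> * a"
proof -
  define f where "f t = \<alpha> * (z t \<bullet> z t) + \<mu> * (\<gamma> t \<bullet> \<gamma> t) + \<nu> \<bullet> \<gamma> t + \<tau> * t" for t
  let ?X = "\<lambda>t. (z t, \<gamma> t)"
  \<comment> \<open>Squares are Lipschitz only on bounded sets; continuity on the compact interval
    supplies the bound \<open>M\<close>.\<close>
  have "compact (?X ` {a..b})"
    by (intro compact_continuous_image absolutely_continuous_on_interval_imp_continuous_on ac) auto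
  then have "bounded (?X ` {a..b})" by (rule compact_imp_bounded)
  then obtain M where "\<forall>x\<in>?X ` {a..b}. norm x \<le> M"
    unfolding bounded_iff ..
  then have M: "norm (?X t) \<le> M" if "t \<in> {a..b}" for t using that by blast
  have Mz: "norm (z t) \<le> M" if "t \<in> {a..b}" for t
    using M[OF that] norm_fst_le[of "z t" "\<gamma> t"] by linarith
  have Mg: "norm (\<gamma> t) \<le> M" if "t \<in> {a..b}" for t
    using M[OF that] norm_snd_le[of "\<gamma> t" "z t"] by linarith
  define C where "C = \<bar>\<alpha>\<bar> * (2 * M) + \<bar>\<mu>\<bar> * (2 * M) + norm \<nu>"
  have ac_f: "absolutely_continuous_on_interval a b f"
  proof (rule absolutely_continuous_on_interval_dominated[OF ac])
    fix s t assume st: "s \<in> {a..b}" "t \<in> {a..b}" "s \<le> t"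
    define n where "n = norm (?X t - ?X s)"
    have n: "norm (z t - z s) \<le> n" "norm (\<gamma> t - \<gamma> s) \<le> n" "0 \<le> n"
      using norm_fst_le[of "z t - z s" "\<gamma> t - \<gamma> s"] norm_snd_le[of "\<gamma> t - \<gamma> s" "z t - z s"] by (simp_all add: n_def)
    have "0 \<le> M" using M[OF st(1)] norm_ge_zero[of "?X s"] by linarith
    have 1: "\<bar>z t \<bullet> z t - z s \<bullet> z s\<bar> \<le> 2 * M * n"
      using inner_self_diff_le[of "z t" M "z s"] Mz st n(1) \<open>0 \<le> M\<close>
      by (meson mult_left_mono mult_nonneg_nonneg order_trans zero_le_numeral)
    have 2: "\<bar>\<gamma> t \<bullet> \<gamma> t - \<gamma> s \<bullet> \<gamma> s\<bar> \<le> 2 * M * n"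
      using inner_self_diff_le[of "\<gamma> t" M "\<gamma> s"] Mg st n(2) \<open>0 \<le> M\<close>
      by (meson mult_left_mono mult_nonneg_nonneg order_trans zero_le_numeral)
    have 3: "\<bar>\<nu> \<bullet> (\<gamma> t - \<gamma> s)\<bar> \<le> norm \<nu> * n"
      using Cauchy_Schwarz_ineq2[of \<nu> "\<gamma> t - \<gamma> s"] n(2) by (meson mult_left_mono norm_ge_zero order_trans)
    have "f t - f s = \<alpha> * (z t \<bullet> z t - z s \<bullet> z s) + \<mu> * (\<gamma> t \<bullet> \<gamma> t - \<gamma> s \<bullet> \<gamma> s) + \<nu> \<bullet> (\<gamma> t - \<gamma> s) + \<tau> * (t - s)"
      by (simp add: f_def inner_diff_right algebra_simps)
    then have "\<bar>f t - f s\<bar> \<le> \<bar>\<alpha>\<bar> * \<bar>z t \<bullet> z t - z s \<bullet> z s\<bar> + \<bar>\<mu>\<bar> * \<bar>\<gamma> t \<bullet> \<gamma> t - \<gamma> s \<bullet> \<gamma> s\<bar>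
        + \<bar>\<nu> \<bullet> (\<gamma> t - \<gamma> s)\<bar> + \<bar>\<tau>\<bar> * \<bar>t - s\<bar>"
      unfolding abs_mult[symmetric] by linarith
    also have "\<dots> \<le> \<bar>\<alpha>\<bar> * (2 * M * n) + \<bar>\<mu>\<bar> * (2 * M * n) + norm \<nu> * n + \<bar>\<tau>\<bar> * (t - s)"
      using st 1 2 3 by (intro add_mono mult_left_mono) auto
    finally show "norm (f t - f s) \<le> C * norm (?X t - ?X s) + \<bar>\<tau>\<bar> * (t - s)"
      unfolding n_def[symmetric] C_def by (simp add: algebra_simps)
  qed
  have "f b \<le> f a"
  proof (rule absolutely_continuous_nonincreasing[OF ab ac_f N])
    fix t assume t: "t \<in> {a..b} - N"
    then obtain v g where X: "(?X has_vector_derivative (v, g)) (at t within {a..b})"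
      and le: "2 * \<alpha> * (z t \<bullet> v) + 2 * \<mu> * (\<gamma> t \<bullet> g) + \<nu> \<bullet> g + \<tau> \<le> 0"
      using deriv by blast
    have z: "(z has_derivative (\<lambda>h. h *\<^sub>R v)) (at t within {a..b})"
      using has_derivative_fst[OF X[unfolded has_vector_derivative_def]] by simp
    have g: "(\<gamma> has_derivative (\<lambda>h. h *\<^sub>R g)) (at t within {a..b})"
      using has_derivative_snd[OF X[unfolded has_vector_derivative_def]] by simp
    have "(f has_real_derivative (2 * \<alpha> * (z t \<bullet> v) + 2 * \<mu> * (\<gamma> t \<bullet> g) + \<nu> \<bullet> g + \<tau>)) (at t within {a..b})"
      unfolding has_field_derivative_def f_def
      by (rule has_derivative_eq_rhs, (rule derivative_intros z g)+)
         (auto simp: fun_eq_iff inner_commute algebra_simps)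
    then show "\<exists>v\<le>0. (f has_real_derivative v) (at t within {a..b})" using le by blast
  qed
  then show ?thesis by (simp add: f_def)
qed

lemma bounded_nondecreasing_tendsto:
  fixes f :: "real \<Rightarrow> real"
  assumes mono: "\<And>s t. \<lbrakk>0 \<le> s; s \<le> t\<rbrakk> \<Longrightarrow> f s \<le> f t" and bound: "\<And>t. 0 \<le> t \<Longrightarrow> f t \<le> B"
  obtains l where "(f \<longlongrightarrow> l) at_top" "\<And>t. 0 \<le> t \<Longrightarrow> f t \<le> l"
proof
  define l where "l = (SUP t\<in>{0..}. f t)"
  have bdd: "bdd_above (f ` {0..})" using bound by (auto intro!: bdd_aboveI)
  show le: "f t \<le> l" if "0 \<le> t" for t
    unfolding l_def using that bdd by (intro cSUP_upper) auto
  show "(f \<longlongrightarrow> l) at_top"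
  proof (rule increasing_tendsto)
    show "\<forall>\<^sub>F t in at_top. f t \<le> l" using eventually_ge_at_top[of 0] by eventually_elim (rule le)
    fix x assume "x < l"
    then obtain s where s: "0 \<le> s" "x < f s"
      unfolding l_def using less_cSUP_iff[OF _ bdd, of x] by auto
    show "\<forall>\<^sub>F t in at_top. x < f t"
      using eventually_ge_at_top[of s] by eventually_elim (use s mono in \<open>meson less_le_trans\<close>)
  qed
qed

text \<open>
  Every limit is obtained by integrating a differential inequality; no bound on the velocity is
  needed. The function \<open>\<Sum>k. \<gamma> k\<close> plays the role of the integral of \<open>\<Sum>k. s k z\<close>.
\<close>

lemma adaptive_gain_convergence:
  fixes z :: "real \<Rightarrow> 'a::euclidean_space" and \<gamma> :: "real \<Rightarrow> real^'e"
    and s :: "'e \<Rightarrow> 'a \<Rightarrow> real"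
  assumes ac: "\<And>a b. \<lbrakk>0 \<le> a; a \<le> b\<rbrakk> \<Longrightarrow> absolutely_continuous_on_interval a b (\<lambda>t. (z t, \<gamma> t))"
    and N: "negligible N"
    and deriv: "\<And>t. \<lbrakk>0 \<le> t; t \<notin> N\<rbrakk> \<Longrightarrow> \<exists>v g. ((\<lambda>t. (z t, \<gamma> t)) has_vector_derivative (v, g)) (at t within {0..}) \<and>
        (\<forall>k. g $ k = \<kappa> * s k (z t)) \<and> z t \<bullet> v \<le> - (\<Sum>k\<in>UNIV. (\<gamma> t $ k - \<gamma>\<^sub>0) * s k (z t))"
    and \<kappa>: "\<kappa> > 0" and s: "\<And>k x. 0 \<le> s k x" and c: "c > 0" "\<And>t. 0 \<le> t \<Longrightarrow> c * norm (z t) \<le> (\<Sum>k\<in>UNIV. s k (z t))"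
  obtains \<gamma>star where "(z \<longlongrightarrow> 0) at_top" "(\<gamma> \<longlongrightarrow> \<gamma>star) at_top"
    "(\<forall>k. \<gamma>star $ k > \<gamma>\<^sub>0) \<Longrightarrow> \<exists>T\<ge>0. \<forall>t\<ge>T. z t = 0"
proof -
  define S where "S t = (\<Sum>k\<in>UNIV. s k (z t))" for t
  define G where "G t = (\<Sum>k\<in>UNIV. \<gamma> t $ k)" for t
  have G1: "(\<chi> k. 1) \<bullet> \<gamma> t = G t" for t by (simp add: inner_vec_def G_def)
  \<comment> \<open>The gain law eliminates the gain velocity, leaving a condition on
    \<open>z t \<bullet> v\<close> alone.\<close>
  have lyap: "\<alpha> * (z b \<bullet> z b) + \<mu> * (\<gamma> b \<bullet> \<gamma> b) + \<nu> \<bullet> \<gamma> b + \<tau> * b \<le>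
      \<alpha> * (z a \<bullet> z a) + \<mu> * (\<gamma> a \<bullet> \<gamma> a) + \<nu> \<bullet> \<gamma> a + \<tau> * a"
    if "0 \<le> a" "a \<le> b" and le: "\<And>t v. \<lbrakk>t \<in> {a..b}; z t \<bullet> v \<le> - (\<Sum>k\<in>UNIV. (\<gamma> t $ k - \<gamma>\<^sub>0) * s k (z t))\<rbrakk>
      \<Longrightarrow> 2 * \<alpha> * (z t \<bullet> v) + (\<Sum>k\<in>UNIV. (2 * \<mu> * \<gamma> t $ k + \<nu> $ k) * (\<kappa> * s k (z t))) + \<tau> \<le> 0"
    for a b \<alpha> \<mu> \<nu> \<tau>
  proof (rule quadratic_lyapunov_nonincreasing[OF that(2) ac[OF that(1,2)] N])
    fix t assume t: "t \<in> {a..b}" "t \<notin> N"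
    then obtain v g where X: "((\<lambda>t. (z t, \<gamma> t)) has_vector_derivative (v, g)) (at t within {0..})"
      and g: "\<And>k. g $ k = \<kappa> * s k (z t)"
      and v: "z t \<bullet> v \<le> - (\<Sum>k\<in>UNIV. (\<gamma> t $ k - \<gamma>\<^sub>0) * s k (z t))"
      using deriv[of t] \<open>0 \<le> a\<close> by auto
    have "((\<lambda>t. (z t, \<gamma> t)) has_vector_derivative (v, g)) (at t within {a..b})"
      using X by (rule has_vector_derivative_within_subset) (use \<open>0 \<le> a\<close> in auto)
    moreover have "2 * \<mu> * (\<gamma> t \<bullet> g) + \<nu> \<bullet> g = (\<Sum>k\<in>UNIV. (2 * \<mu> * \<gamma> t $ k + \<nu> $ k) * (\<kappa> * s k (z t)))"
      by (simp add: inner_vec_def g sum_distrib_left sum.distrib algebra_simps)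
    ultimately show "\<exists>v g. ((\<lambda>t. (z t, \<gamma> t)) has_vector_derivative (v, g)) (at t within {a..b}) \<and>
        2 * \<alpha> * (z t \<bullet> v) + 2 * \<mu> * (\<gamma> t \<bullet> g) + \<nu> \<bullet> g + \<tau> \<le> 0"
      using le[OF t(1) v] by (intro exI[of _ v] exI[of _ g]) auto
  qed
  have \<gamma>_mono: "\<gamma> a $ k \<le> \<gamma> b $ k" if "0 \<le> a" "a \<le> b" for a b k
  proof -
    have "(\<Sum>j\<in>UNIV. (2 * 0 * \<gamma> t $ j + (- axis k 1) $ j) * (\<kappa> * s j (z t))) \<le> 0" for t
      using \<kappa> s by (intro sum_nonpos mult_nonpos_nonneg mult_nonneg_nonneg) (auto simp: axis_def)
    then have "(- axis k 1) \<bullet> \<gamma> b \<le> (- axis k 1) \<bullet> \<gamma> a"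
      using lyap[OF that, of 0 0 "- axis k 1" 0] by simp
    then show ?thesis by (simp add: inner_axis' inner_minus_left)
  qed
  \<comment> \<open>The first Lyapunov function with its square expanded and the constant
    \<open>CARD('e) * \<gamma>\<^sub>0\<^sup>2 / (2 * \<kappa>)\<close> dropped; \<open>B\<close>
    restores that constant, scaled by \<open>2 * \<kappa>\<close>.\<close>
  define W where "W t = z t \<bullet> z t / 2 + \<gamma> t \<bullet> \<gamma> t / (2 * \<kappa>) - \<gamma>\<^sub>0 * G t / \<kappa>" for t
  have W: "W t \<le> W 0" if "0 \<le> t" for t
  proof -
    have "1 / 2 * (z t \<bullet> z t) + 1 / (2 * \<kappa>) * (\<gamma> t \<bullet> \<gamma> t) + ((- \<gamma>\<^sub>0 / \<kappa>) *\<^sub>R (\<chi> k. 1)) \<bullet> \<gamma> t + 0 * t \<le>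
        1 / 2 * (z 0 \<bullet> z 0) + 1 / (2 * \<kappa>) * (\<gamma> 0 \<bullet> \<gamma> 0) + ((- \<gamma>\<^sub>0 / \<kappa>) *\<^sub>R (\<chi> k. 1)) \<bullet> \<gamma> 0 + 0 * 0"
    proof (rule lyap)
      fix t v assume v: "z t \<bullet> v \<le> - (\<Sum>k\<in>UNIV. (\<gamma> t $ k - \<gamma>\<^sub>0) * s k (z t))"
      have "(\<Sum>k\<in>UNIV. (2 * (1 / (2 * \<kappa>)) * \<gamma> t $ k + ((- \<gamma>\<^sub>0 / \<kappa>) *\<^sub>R (\<chi> k. 1)) $ k) * (\<kappa> * s k (z t)))
          = (\<Sum>k\<in>UNIV. (\<gamma> t $ k - \<gamma>\<^sub>0) * s k (z t))"
        using \<kappa> by (intro sum.cong) (auto simp: field_simps)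
      with v show "2 * (1 / 2) * (z t \<bullet> v) + (\<Sum>k\<in>UNIV. (2 * (1 / (2 * \<kappa>)) * \<gamma> t $ k +
          ((- \<gamma>\<^sub>0 / \<kappa>) *\<^sub>R (\<chi> k. 1)) $ k) * (\<kappa> * s k (z t))) + 0 \<le> 0"
        by simp
    qed (use that in auto)
    then show ?thesis by (simp add: W_def G1)
  qed
  define B where "B = 2 * \<kappa> * W 0 + CARD('e) * \<gamma>\<^sub>0\<^sup>2"
  have \<gamma>_bound: "(\<gamma> t $ k - \<gamma>\<^sub>0)\<^sup>2 \<le> B" if "0 \<le> t" for t k
  proof -
    have "(\<gamma> t $ k - \<gamma>\<^sub>0)\<^sup>2 \<le> (\<Sum>k\<in>UNIV. (\<gamma> t $ k - \<gamma>\<^sub>0)\<^sup>2)"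
      by (intro member_le_sum) auto
    also have "\<dots> = \<gamma> t \<bullet> \<gamma> t - 2 * \<gamma>\<^sub>0 * G t + CARD('e) * \<gamma>\<^sub>0\<^sup>2"
      by (simp add: power2_diff sum.distrib sum_subtractf inner_vec_def G_def sum_distrib_left power2_eq_square algebra_simps)
    also have "\<dots> = 2 * \<kappa> * (W t - z t \<bullet> z t / 2) + CARD('e) * \<gamma>\<^sub>0\<^sup>2"
      using \<kappa> by (simp add: W_def field_simps)
    also have "\<dots> \<le> B"
      unfolding B_def using W[OF that] \<kappa> inner_ge_zero[of "z t"]
      by (intro add_right_mono mult_left_mono) linarith+
    finally show ?thesis .
  qed
  define C where "C = sqrt B"
  have C: "\<bar>\<gamma> t $ k - \<gamma>\<^sub>0\<bar> \<le> C" if "0 \<le> t" for t k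
    unfolding C_def using \<gamma>_bound[OF that] by (simp add: real_le_rsqrt)
  have "C \<ge> 0" using C[of 0] abs_ge_zero order_trans by blast
  have "\<exists>l. ((\<lambda>t. \<gamma> t $ k) \<longlongrightarrow> l) at_top" for k
  proof (rule bounded_nondecreasing_tendsto[of "\<lambda>t. \<gamma> t $ k" "\<gamma>\<^sub>0 + C"])
    show "\<gamma> t $ k \<le> \<gamma>\<^sub>0 + C" if "0 \<le> t" for t using C[OF that, of k] by linarith
  qed (use \<gamma>_mono in auto)
  then obtain L where L: "\<And>k. ((\<lambda>t. \<gamma> t $ k) \<longlongrightarrow> L k) at_top" by metis
  define \<gamma>star where "\<gamma>star = (\<chi> k. L k)"
  have lim\<gamma>: "(\<gamma> \<longlongrightarrow> \<gamma>star) at_top" unfolding \<gamma>star_def by (rule vec_tendstoI) (simp add: L)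
  have limG: "(G \<longlongrightarrow> (\<Sum>k\<in>UNIV. L k)) at_top" unfolding G_def by (intro tendsto_sum L)
  have G_le: "G t \<le> CARD('e) * (\<gamma>\<^sub>0 + C)" if "0 \<le> t" for t
    unfolding G_def using C[OF that] by (intro sum_bounded_above[THEN order_trans]) (auto simp: abs_le_iff algebra_simps)
  \<comment> \<open>Gains below \<open>\<gamma>\<^sub>0\<close> may let the error grow, but at a
    rate of at most \<open>C\<close> times the sum of the \<open>s k (z t)\<close>, which the growth
    of \<open>G\<close> compensates.\<close>
  have V_mono: "1 / 2 * (z b \<bullet> z b) - C / \<kappa> * G b \<le> 1 / 2 * (z a \<bullet> z a) - C / \<kappa> * G a" if "0 \<le> a" "a \<le> b" for a b
  proof -
    have "1 / 2 * (z b \<bullet> z b) + 0 * (\<gamma> b \<bullet> \<gamma> b) + ((- C / \<kappa>) *\<^sub>R (\<chi> k. 1)) \<bullet> \<gamma> b + 0 * b \<le>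
        1 / 2 * (z a \<bullet> z a) + 0 * (\<gamma> a \<bullet> \<gamma> a) + ((- C / \<kappa>) *\<^sub>R (\<chi> k. 1)) \<bullet> \<gamma> a + 0 * a"
    proof (rule lyap[OF that])
      fix t v assume t: "t \<in> {a..b}" and v: "z t \<bullet> v \<le> - (\<Sum>k\<in>UNIV. (\<gamma> t $ k - \<gamma>\<^sub>0) * s k (z t))"
      have "- (\<Sum>k\<in>UNIV. (\<gamma> t $ k - \<gamma>\<^sub>0) * s k (z t)) \<le> (\<Sum>k\<in>UNIV. C * s k (z t))"
        unfolding sum_negf[symmetric] mult_minus_left[symmetric]
        using C[of t] t \<open>0 \<le> a\<close> s by (intro sum_mono mult_right_mono) (auto simp: abs_le_iff)
      moreover have "(\<Sum>k\<in>UNIV. (2 * 0 * \<gamma> t $ k + ((- C / \<kappa>) *\<^sub>R (\<chi> k. 1)) $ k) * (\<kappa> * s k (z t))) =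
          - (\<Sum>k\<in>UNIV. C * s k (z t))"
        using \<kappa> by (simp add: sum_negf)
      ultimately show "2 * (1 / 2) * (z t \<bullet> v) + (\<Sum>k\<in>UNIV. (2 * 0 * \<gamma> t $ k +
          ((- C / \<kappa>) *\<^sub>R (\<chi> k. 1)) $ k) * (\<kappa> * s k (z t))) + 0 \<le> 0"
        using v by simp
    qed
    then show ?thesis by (simp add: G1)
  qed
  have "\<exists>l. ((\<lambda>t. C / \<kappa> * G t - 1 / 2 * (z t \<bullet> z t)) \<longlongrightarrow> l) at_top"
  proof (rule bounded_nondecreasing_tendsto)
    show "C / \<kappa> * G t - 1 / 2 * (z t \<bullet> z t) \<le> C / \<kappa> * (CARD('e) * (\<gamma>\<^sub>0 + C))" if "0 \<le> t" for t
    proof -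
      have "C / \<kappa> * G t \<le> C / \<kappa> * (CARD('e) * (\<gamma>\<^sub>0 + C))"
        using G_le[OF that] \<open>C \<ge> 0\<close> \<kappa> by (intro mult_left_mono) auto
      then show ?thesis using inner_ge_zero[of "z t"] by linarith
    qed
    show "C / \<kappa> * G a - 1 / 2 * (z a \<bullet> z a) \<le> C / \<kappa> * G b - 1 / 2 * (z b \<bullet> z b)" if "0 \<le> a" "a \<le> b" for a b
      using V_mono[OF that] by linarith
  qed blast
  then obtain l where "((\<lambda>t. C / \<kappa> * G t - 1 / 2 * (z t \<bullet> z t)) \<longlongrightarrow> l) at_top" by blast
  note lim = tendsto_mult_left[OF tendsto_diff[OF tendsto_mult_left[OF limG, of "C / \<kappa>"] this], of 2]
  \<comment> \<open>Since \<open>G\<close> converges too, convergence of the combined function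
    yields a limit \<open>q\<close> for the squared norm.\<close>
  define q where "q = 2 * (C / \<kappa> * (\<Sum>k\<in>UNIV. L k) - l)"
  have limz: "((\<lambda>t. z t \<bullet> z t) \<longlongrightarrow> q) at_top" using lim by (simp add: q_def)
  have q0: "q \<ge> 0" using limz by (rule tendsto_lowerbound) auto
  have "\<not> q > 0"
  proof
    assume "q > 0"
    define r where "r = sqrt (q / 2)"
    have "r > 0" using \<open>q > 0\<close> by (simp add: r_def)
    have "\<forall>\<^sub>F t in at_top. q / 2 < z t \<bullet> z t" 
      by (rule order_tendstoD(1)[OF limz]) (use \<open>q > 0\<close> in linarith)
    then have "\<forall>\<^sub>F t in at_top. 0 \<le> t \<and> r \<le> norm (z t)"
      using eventually_ge_at_top[of 0]
      by eventually_elim (simp add: r_def norm_eq_sqrt_inner real_sqrt_le_iff)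
    then obtain T where T: "\<And>t. T \<le> t \<Longrightarrow> 0 \<le> t \<and> r \<le> norm (z t)" by (auto simp: eventually_at_top_linorder)
    have "T \<ge> 0" using T by blast
    \<comment> \<open>By time \<open>b\<close>, growth of \<open>G\<close> at rate
      \<open>\<kappa> * c * r\<close> carries it at least one unit past its upper bound.\<close>
    define b where "b = T + (CARD('e) * (\<gamma>\<^sub>0 + C) - G T + 1) / (\<kappa> * c * r)"
    have pos: "\<kappa> * c * r > 0" using \<kappa> c(1) \<open>r > 0\<close> by simp
    have "T \<le> b" using G_le[OF \<open>T \<ge> 0\<close>] pos by (simp add: b_def)
    have "0 * (z b \<bullet> z b) + 0 * (\<gamma> b \<bullet> \<gamma> b) + (- (\<chi> k. 1)) \<bullet> \<gamma> b + (\<kappa> * c * r) * b \<le>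
        0 * (z T \<bullet> z T) + 0 * (\<gamma> T \<bullet> \<gamma> T) + (- (\<chi> k. 1)) \<bullet> \<gamma> T + (\<kappa> * c * r) * T"
    proof (rule lyap[OF \<open>T \<ge> 0\<close> \<open>T \<le> b\<close>])
      fix t v assume t: "t \<in> {T..b}"
      have "c * r \<le> c * norm (z t)" using T t c(1) by (intro mult_left_mono) auto
      also have "\<dots> \<le> S t" using c(2) T t by (simp add: S_def)
      finally have "\<kappa> * (c * r) \<le> \<kappa> * S t" using \<kappa> by (intro mult_left_mono) auto
      then show "2 * 0 * (z t \<bullet> v) + (\<Sum>k\<in>UNIV. (2 * 0 * \<gamma> t $ k + (- (\<chi> k. 1)) $ k) * (\<kappa> * s k (z t)))
          + \<kappa> * c * r \<le> 0"
        by (simp add: sum_negf sum_distrib_left S_def mult.assoc)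
    qed
    then have "\<kappa> * c * r * (b - T) \<le> G b - G T" by (simp add: G1 inner_minus_left right_diff_distrib)
    also have "\<kappa> * c * r * (b - T) = CARD('e) * (\<gamma>\<^sub>0 + C) - G T + 1"
      using \<kappa> c(1) \<open>r > 0\<close> by (simp add: b_def)
    finally show False using G_le[of b] \<open>T \<ge> 0\<close> \<open>T \<le> b\<close> by linarith
  qed
  then have "q = 0" using q0 by linarith
  then have "((\<lambda>t. norm (z t)) \<longlongrightarrow> 0) at_top"
    using tendsto_real_sqrt[OF limz] by (simp add: norm_eq_sqrt_inner)
  then have lim0: "(z \<longlongrightarrow> 0) at_top" by (rule tendsto_norm_zero_cancel)
  have finite_time: "\<exists>T\<ge>0. \<forall>t\<ge>T. z t = 0" if big: "\<forall>k. \<gamma>star $ k > \<gamma>\<^sub>0"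
  proof -
    \<comment> \<open>Half the smallest limiting margin, so that every gain eventually exceeds
      \<open>\<gamma>\<^sub>0 + m\<close>.\<close>
    define m where "m = Min (range (\<lambda>k. (\<gamma>star $ k - \<gamma>\<^sub>0) / 2))"
    have m: "m \<le> (\<gamma>star $ k - \<gamma>\<^sub>0) / 2" for k unfolding m_def by (intro Min_le) auto
    have "m > 0" unfolding m_def using big by (subst Min_gr_iff) auto
    have "\<forall>\<^sub>F t in at_top. \<gamma>\<^sub>0 + m < \<gamma> t $ k" for k
    proof (rule order_tendstoD(1)[OF L[of k]])
      have "\<gamma>star $ k = L k" by (simp add: \<gamma>star_def)
      then show "\<gamma>\<^sub>0 + m < L k" using m[of k] \<open>m > 0\<close> by (simp add: field_simps)
    qed
    then have "\<forall>\<^sub>F t in at_top. \<forall>k. \<gamma>\<^sub>0 + m < \<gamma> t $ k" by (rule eventually_all_finite)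
    then have "\<forall>\<^sub>F t in at_top. 0 \<le> t \<and> (\<forall>k. \<gamma>\<^sub>0 + m < \<gamma> t $ k)"
      using eventually_ge_at_top[of 0] by eventually_elim simp
    then obtain T where T: "\<And>t k. T \<le> t \<Longrightarrow> 0 \<le> t \<and> \<gamma>\<^sub>0 + m < \<gamma> t $ k"
      by (auto simp: eventually_at_top_linorder)
    have "T \<ge> 0" using T by blast
    have decay: "z t \<bullet> v \<le> - (m * c * norm (z t))"
      if t: "T \<le> t" and v: "z t \<bullet> v \<le> - (\<Sum>k\<in>UNIV. (\<gamma> t $ k - \<gamma>\<^sub>0) * s k (z t))" for t v
    proof -
      have "m * (c * norm (z t)) \<le> m * S t"
        using c(2)[of t] T[OF t] \<open>m > 0\<close> by (intro mult_left_mono) (auto simp: S_def)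
      also have "\<dots> = (\<Sum>k\<in>UNIV. m * s k (z t))" by (simp add: S_def sum_distrib_left)
      also have "\<dots> \<le> (\<Sum>k\<in>UNIV. (\<gamma> t $ k - \<gamma>\<^sub>0) * s k (z t))"
        using T[OF t] s by (intro sum_mono mult_right_mono) (auto simp: less_imp_le algebra_simps)
      finally show ?thesis using v by (simp add: mult.assoc)
    qed
    \<comment> \<open>Decay at rate \<open>m * c\<close> up to this time would bring the norm down
      to at most minus one.\<close>
    define b where "b = T + (norm (z T) + 1) / (m * c)"
    have "m * c > 0" using \<open>m > 0\<close> c(1) by simp
    then have "T \<le> b" by (simp add: b_def)
    \<comment> \<open>The norm is differentiable only away from zero, so its decay is integrated
      under the assumption that \<open>z\<close> never vanishes on the interval.\<close>
    have "\<exists>t\<in>{T..b}. z t = 0"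
    proof (rule ccontr)
      assume "\<not> (\<exists>t\<in>{T..b}. z t = 0)"
      then have nz: "z t \<noteq> 0" if "t \<in> {T..b}" for t using that by blast
      define f where "f t = norm (z t) + m * c * t" for t
      have "f b \<le> f T"
      proof (rule absolutely_continuous_nonincreasing[OF \<open>T \<le> b\<close> _ N])
        show "absolutely_continuous_on_interval T b f"
        proof (rule absolutely_continuous_on_interval_dominated[OF ac[OF \<open>T \<ge> 0\<close> \<open>T \<le> b\<close>]])
          fix s t :: real assume "s \<le> t"
          have "\<bar>norm (z t) - norm (z s)\<bar> \<le> norm (z t - z s)" by (rule norm_triangle_ineq3)
          also have "\<dots> \<le> norm ((z t, \<gamma> t) - (z s, \<gamma> s))"
            using norm_fst_le[of "z t - z s" "\<gamma> t - \<gamma> s"] by simp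
          finally have *: "\<bar>norm (z t) - norm (z s)\<bar> \<le> norm ((z t, \<gamma> t) - (z s, \<gamma> s))" .
          have "f t - f s = (norm (z t) - norm (z s)) + m * c * (t - s)" by (simp add: f_def algebra_simps)
          moreover have "0 \<le> m * c * (t - s)" using \<open>s \<le> t\<close> \<open>m * c > 0\<close> by simp
          ultimately show "norm (f t - f s) \<le> 1 * norm ((z t, \<gamma> t) - (z s, \<gamma> s)) + m * c * (t - s)"
            using * by simp
        qed
        fix t assume t: "t \<in> {T..b} - N"
        then obtain v g where X: "((\<lambda>t. (z t, \<gamma> t)) has_vector_derivative (v, g)) (at t within {0..})"
          and v: "z t \<bullet> v \<le> - (\<Sum>k\<in>UNIV. (\<gamma> t $ k - \<gamma>\<^sub>0) * s k (z t))"
          using deriv[of t] \<open>T \<ge> 0\<close> by auto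
        have X': "((\<lambda>t. (z t, \<gamma> t)) has_vector_derivative (v, g)) (at t within {T..b})"
          using X by (rule has_vector_derivative_within_subset) (use \<open>T \<ge> 0\<close> in auto)
        have z: "(z has_derivative (\<lambda>h. h *\<^sub>R v)) (at t within {T..b})"
          using has_derivative_fst[OF X'[unfolded has_vector_derivative_def]] by simp
        have "z t \<noteq> 0" using nz t by simp
        have n: "((\<lambda>t. norm (z t)) has_derivative (\<lambda>h. (h *\<^sub>R v) \<bullet> sgn (z t))) (at t within {T..b})"
          using has_derivative_compose[OF z has_derivative_norm[OF \<open>z t \<noteq> 0\<close>]] .
        have "(f has_real_derivative ((z t \<bullet> v) / norm (z t) + m * c)) (at t within {T..b})"
          unfolding has_field_derivative_def f_def
          by (rule has_derivative_eq_rhs, (rule derivative_intros n)+)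
             (auto simp: fun_eq_iff sgn_div_norm inner_commute divide_inverse algebra_simps)
        moreover have "(z t \<bullet> v) / norm (z t) + m * c \<le> 0"
          using decay[OF _ v] t \<open>z t \<noteq> 0\<close> by (simp add: field_simps)
        ultimately show "\<exists>v\<le>0. (f has_real_derivative v) (at t within {T..b})" by blast
      qed
      then have "norm (z b) + m * c * (b - T) \<le> norm (z T)" by (simp add: f_def algebra_simps)
      moreover have "m * c * (b - T) = norm (z T) + 1" using \<open>m > 0\<close> c(1) by (simp add: b_def)
      ultimately show False using norm_ge_zero[of "z b"] by linarith
    qed
    then obtain T' where T': "T \<le> T'" "z T' = 0" by auto
    \<comment> \<open>The squared norm is smooth at zero and nonincreasing after \<open>T\<close>,
      so the error cannot leave zero again.\<close>
    have "z t = 0" if "T' \<le> t" for t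
    proof -
      have "1 * (z t \<bullet> z t) + 0 * (\<gamma> t \<bullet> \<gamma> t) + 0 \<bullet> \<gamma> t + 0 * t \<le>
          1 * (z T' \<bullet> z T') + 0 * (\<gamma> T' \<bullet> \<gamma> T') + 0 \<bullet> \<gamma> T' + 0 * T'"
      proof (rule lyap)
        fix u v assume "u \<in> {T'..t}" and v: "z u \<bullet> v \<le> - (\<Sum>k\<in>UNIV. (\<gamma> u $ k - \<gamma>\<^sub>0) * s k (z u))"
        then have "z u \<bullet> v \<le> - (m * c * norm (z u))" using T' by (intro decay) auto
        also have "\<dots> \<le> 0" using \<open>m * c > 0\<close> by simp
        finally show "2 * 1 * (z u \<bullet> v) + (\<Sum>k\<in>UNIV. (2 * 0 * \<gamma> u $ k + 0 $ k) * (\<kappa> * s k (z u))) + 0 \<le> 0"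
          by simp
      qed (use that T' \<open>T \<ge> 0\<close> in auto)
      then show ?thesis using T'(2) inner_ge_zero[of "z t"] by simp
    qed
    then show ?thesis using T' \<open>T \<ge> 0\<close> by (intro exI[of _ T']) auto
  qed
  show thesis by (rule that[OF lim0 lim\<gamma> finite_time])
qed

section \<open>The formation\<close>

definition extend_leaders :: "real^'d^'f \<Rightarrow> real^'d^('l::finite + 'f::finite)" where
  "extend_leaders x = (\<chi> i. case i of Inl a \<Rightarrow> 0 | Inr b \<Rightarrow> x $ b)"

lemma with_leaders_diff:
  "with_leaders pstar y - pstar = extend_leaders (y - (\<chi> b. pstar $ Inr b))"
  by (simp add: with_leaders_def extend_leaders_def vec_eq_iff split: sum.split)

lemma norm_extend_leaders: "norm (extend_leaders x) = norm x"
proof -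
  have "extend_leaders x \<bullet> extend_leaders x = x \<bullet> x"
    by (simp add: inner_vec_def[of "extend_leaders x"] inner_vec_def[of x] sum_UNIV_Plus)
       (simp add: extend_leaders_def)
  then show ?thesis by (simp add: norm_eq_sqrt_inner)
qed

theorem theorem1:
  fixes E :: "('l::finite + 'f::finite) set set"
    and src tgt :: "'e::finite \<Rightarrow> 'l + 'f"
    and pstar :: "real^'d^('l + 'f)"
    and w :: "real \<Rightarrow> real^'d^('l + 'f)"
    and p :: "real \<Rightarrow> real^'d^('l + 'f)"
    and \<gamma> :: "real \<Rightarrow> real^'e"
    and \<kappa> \<beta> \<gamma>\<^sub>0 :: real
  assumes "CARD('d) \<ge> 2"
    and "CARD('l) \<ge> 2"
    and "oriented_graph E src tgt"
    and "inj (\<lambda>i. pstar $ i)"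
    and "infinitesimally_bearing_rigid src tgt pstar"
    and "bounded (w ` {0..})"
    and "uniformly_continuous_on {0..} w"
    and "\<beta> = (SUP t\<in>{0..}. infnorm (w t))"
    and "\<beta> > 0"
    and "\<kappa> > 0"
    and "\<forall>t\<ge>0. \<forall>i. p t $ Inl i = pstar $ Inl i"
    and "\<forall>k. \<gamma> 0 $ k > 0"
    and "\<forall>t\<ge>0. \<forall>i j. i \<noteq> j \<longrightarrow> p t $ i \<noteq> p t $ j"
    and "filippov_solution (closed_loop pstar E src tgt \<kappa> w)
           (\<lambda>t. (\<chi> i. p t $ Inr i, \<gamma> t))"
    and "\<gamma>\<^sub>0 = \<beta> * sqrt (real (CARD('d) * CARD('l + 'f)) /
                 min_eigenvalue (follower_block (bearing_laplacian src tgt pstar)))"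
  shows "(p \<longlongrightarrow> pstar) at_top \<and>
         (\<exists>\<gamma>star. (\<gamma> \<longlongrightarrow> \<gamma>star) at_top \<and>
           ((\<forall>k. \<gamma>star $ k > \<gamma>\<^sub>0) \<and>
            (\<exists>T\<ge>0. \<forall>k. \<bar>\<gamma> T $ k - \<gamma>star $ k\<bar> < (MIN k'. \<bar>\<gamma> T $ k' - \<gamma>\<^sub>0\<bar>))
            \<longrightarrow> (\<exists>T'\<ge>0. \<forall>t\<ge>T'. p t = pstar)))"
proof -
  note G = assms(3) and \<kappa> = assms(10) and sol = assms(14)
  define \<mu> where "\<mu> = min_eigenvalue (follower_block (bearing_laplacian src tgt pstar))"
  note \<mu>_pos = min_eigenvalue_follower_block_pos[OF assms(3,5,4,2), folded \<mu>_def]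
  note \<mu>_le = min_eigenvalue_follower_block_le[OF assms(3,5,4,2), folded \<mu>_def]
  define ystar where "ystar = (\<chi> i. pstar $ Inr i)"
  define y where "y t = (\<chi> i. p t $ Inr i)" for t
  define z where "z t = y t - ystar" for t
  define s where "s k x = norm1 (displacement pstar (extend_leaders x) (src k) (tgt k))" for k x
  have p: "p t = with_leaders pstar (y t)" if "0 \<le> t" for t
    using assms(11) that by (simp add: with_leaders_def y_def vec_eq_iff split: sum.split)
  have ext: "with_leaders pstar (y t) - pstar = extend_leaders (z t)" for t
    by (simp add: with_leaders_diff z_def ystar_def)

  \<comment> \<open>The Euclidean norm is bounded by the sum norm twice: across the edges, then
    within each displacement.\<close>
  have s_ge: "sqrt \<mu> * norm x \<le> (\<Sum>k\<in>UNIV. s k x)" for x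
  proof -
    let ?q = "\<lambda>k. displacement pstar (extend_leaders x) (src k) (tgt k)"
    have "sqrt \<mu> * norm x = sqrt (\<mu> * (norm (extend_leaders x :: real^'d^('l + 'f)))\<^sup>2)"
      by (simp add: norm_extend_leaders real_sqrt_mult)
    also have "\<dots> \<le> L2_set (\<lambda>k. norm (?q k)) UNIV"
      unfolding L2_set_def using \<mu>_le[of "extend_leaders x"]
      by (intro real_sqrt_le_mono) (simp add: extend_leaders_def)
    also have "\<dots> \<le> (\<Sum>k\<in>UNIV. norm (?q k))" by (intro L2_set_le_sum) auto
    also have "\<dots> \<le> (\<Sum>k\<in>UNIV. s k x)" unfolding s_def by (intro sum_mono norm_le_norm1)
    finally show ?thesis .
  qed

  \<comment> \<open>The dimension factor comes from passing from the maximum norm, in which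
    \<open>\<beta>\<close> is measured, to the Euclidean norm.\<close>
  have w_le: "norm (w t) \<le> sqrt (real (CARD('d) * CARD('l + 'f))) * \<beta>" if "0 \<le> t" for t
  proof -
    obtain M where "\<forall>x\<in>w ` {0..}. norm x \<le> M" using assms(6) unfolding bounded_iff ..
    then have "bdd_above ((\<lambda>t. infnorm (w t)) ` {0..})"
      by (auto intro!: bdd_aboveI[of _ M] order_trans[OF infnorm_le_norm])
    then have "infnorm (w t) \<le> \<beta>" unfolding assms(8) using that by (intro cSUP_upper) auto
    then have "sqrt (real DIM(real^'d^('l + 'f))) * infnorm (w t) \<le> sqrt (real DIM(real^'d^('l + 'f))) * \<beta>"
      by (intro mult_left_mono) auto
    with norm_le_infnorm[of "w t"] show ?thesis by (simp add: mult.commute)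
  qed
  have dist_le: "extend_leaders (z t) \<bullet> w t \<le> \<gamma>\<^sub>0 * (\<Sum>k\<in>UNIV. s k (z t))" if "0 \<le> t" for t
  proof -
    have "extend_leaders (z t) \<bullet> w t \<le> norm (z t) * norm (w t)"
      using norm_cauchy_schwarz[of "extend_leaders (z t)" "w t"] by (simp add: norm_extend_leaders)
    also have "\<dots> \<le> norm (z t) * (sqrt (real (CARD('d) * CARD('l + 'f))) * \<beta>)"
      by (intro mult_left_mono w_le that) auto
    \<comment> \<open>This identity explains the value of \<open>\<gamma>\<^sub>0\<close>: the
      disturbance bound is exactly \<open>\<gamma>\<^sub>0 * sqrt \<mu>\<close>.\<close>
    also have "\<dots> = \<gamma>\<^sub>0 * (sqrt \<mu> * norm (z t))"
      using \<mu>_pos by (simp add: assms(15) \<mu>_def[symmetric] real_sqrt_divide)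
    also have "\<dots> \<le> \<gamma>\<^sub>0 * (\<Sum>k\<in>UNIV. s k (z t))"
      using assms(9) \<mu>_pos by (intro mult_left_mono s_ge) (simp add: assms(15) \<mu>_def[symmetric])
    finally show ?thesis .
  qed

  have ac: "absolutely_continuous_on_interval a b (\<lambda>t. (z t, \<gamma> t))" if "0 \<le> a" "a \<le> b" for a b
  proof (rule absolutely_continuous_on_interval_dominated[where C = 1 and C' = 0])
    show "absolutely_continuous_on_interval a b (\<lambda>t. (y t, \<gamma> t))"
      using sol that by (simp add: filippov_solution_def y_def)
  qed (simp add: z_def)
  have "AE t in lebesgue. 0 \<le> t \<longrightarrow> (\<exists>v \<in> filippov_map (closed_loop pstar E src tgt \<kappa> w) t (y t, \<gamma> t).
      ((\<lambda>t. (y t, \<gamma> t)) has_vector_derivative v) (at t within {0..}))"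
    using sol by (simp add: filippov_solution_def y_def)
  then obtain N where N: "N \<in> null_sets lebesgue" and
    sub: "{t \<in> space lebesgue. \<not> (0 \<le> t \<longrightarrow> (\<exists>v \<in> filippov_map (closed_loop pstar E src tgt \<kappa> w) t (y t, \<gamma> t).
      ((\<lambda>t. (y t, \<gamma> t)) has_vector_derivative v) (at t within {0..})))} \<subseteq> N"
    unfolding eventually_ae_filter by blast
  have deriv: "\<exists>v \<in> filippov_map (closed_loop pstar E src tgt \<kappa> w) t (y t, \<gamma> t).
      ((\<lambda>t. (y t, \<gamma> t)) has_vector_derivative v) (at t within {0..})" if "0 \<le> t" "t \<notin> N" for t
    using sub that by auto
  have deriv': "\<exists>v g. ((\<lambda>t. (z t, \<gamma> t)) has_vector_derivative (v, g)) (at t within {0..}) \<and>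
      (\<forall>k. g $ k = \<kappa> * s k (z t)) \<and> z t \<bullet> v \<le> - (\<Sum>k\<in>UNIV. (\<gamma> t $ k - \<gamma>\<^sub>0) * s k (z t))"
    if t: "0 \<le> t" "t \<notin> N" for t
  proof -
    obtain v where v: "v \<in> filippov_map (closed_loop pstar E src tgt \<kappa> w) t (y t, \<gamma> t)"
      and yv: "((\<lambda>t. (y t, \<gamma> t)) has_vector_derivative v) (at t within {0..})"
      using deriv[OF t] by blast
    have "((\<lambda>t. (y t, \<gamma> t) - (ystar, 0)) has_vector_derivative v - 0) (at t within {0..})"
      by (intro has_vector_derivative_diff yv has_vector_derivative_const)
    then have "((\<lambda>t. (z t, \<gamma> t)) has_vector_derivative (fst v, snd v)) (at t within {0..})"
      by (simp add: z_def)
    moreover have "snd v $ k = \<kappa> * s k (z t)" for k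
      using filippov_map_closed_loop(2)[OF G v] by (simp add: ext s_def)
    moreover have "z t \<bullet> fst v \<le> - (\<Sum>k\<in>UNIV. (\<gamma> t $ k - \<gamma>\<^sub>0) * s k (z t))"
    proof -
      have "z t \<bullet> fst v = - (\<Sum>k\<in>UNIV. \<gamma> t $ k * s k (z t)) + extend_leaders (z t) \<bullet> w t"
        using filippov_map_closed_loop(1)[OF G v] by (simp add: ext s_def flip: ystar_def z_def)
      with dist_le[OF t(1)] show ?thesis
        by (simp add: left_diff_distrib sum_subtractf sum_distrib_left)
    qed
    ultimately show ?thesis by blast
  qed
  obtain \<gamma>star where z0: "(z \<longlongrightarrow> 0) at_top" and \<gamma>star: "(\<gamma> \<longlongrightarrow> \<gamma>star) at_top"
    and fin: "(\<forall>k. \<gamma>star $ k > \<gamma>\<^sub>0) \<Longrightarrow> \<exists>T\<ge>0. \<forall>t\<ge>T. z t = 0"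
  proof (rule adaptive_gain_convergence[OF ac _ deriv' \<kappa>])
    show "negligible N" using N by (simp add: negligible_iff_null_sets)
    show "0 \<le> s k x" for k x by (simp add: s_def norm1_nonneg)
    show "sqrt \<mu> > 0" using \<mu>_pos by simp
  qed (use s_ge in auto)
  have norm_p: "norm (p t - pstar) = norm (z t)" if "0 \<le> t" for t
    by (simp add: p[OF that] ext norm_extend_leaders)
  have "((\<lambda>t. norm (p t - pstar)) \<longlongrightarrow> 0) at_top"
  \<comment> \<open>The leaders are known to be at their targets only for nonnegative times, so the
    two norms agree only eventually.\<close>
  proof (rule Lim_transform_eventually)
    show "((\<lambda>t. norm (z t)) \<longlongrightarrow> 0) at_top" using z0 by (rule tendsto_norm_zero)
    show "\<forall>\<^sub>F t in at_top. norm (z t) = norm (p t - pstar)"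
      using eventually_ge_at_top[of 0] by eventually_elim (simp add: norm_p)
  qed
  then have "(p \<longlongrightarrow> pstar) at_top" by (simp add: tendsto_norm_zero_iff LIM_zero_iff)
  moreover have "\<exists>T'\<ge>0. \<forall>t\<ge>T'. p t = pstar" if big: "\<forall>k. \<gamma>star $ k > \<gamma>\<^sub>0"
  proof -
    obtain T where "T \<ge> 0" "\<forall>t\<ge>T. z t = 0" using fin[OF big] by blast
    moreover have "p t = pstar" if "t \<ge> T" for t
      using norm_p[of t] that calculation by auto
    ultimately show ?thesis by blast
  qed
  ultimately show ?thesis using \<gamma>star by blast
qed

end
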